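(* Let $(X,r)$ be a square-free non-degenerate symmetric set of arbitrary cardinality (with $S(X,r)$ embedded in $G=G(X,r)$) which is not the trivial solution. (1) The following are equivalent: (a) $\mathrm{mpl}(X,r)=2$; (b) $\mathrm{mpl}(G,r_G)=2$; (c) $G$ acts upon itself as automorphisms, equivalently $\mathcal{L}_{{}^ba}=\mathcal{L}_a$ for all $a,b\in G$; (d) $(G,r_G)$ satisfies lri; (e) the left brace $(G,+,\cdot)$ satisfies Raut. (2) More generally, for $m\ge2$: $\mathrm{mpl}(X,r)=m$ if and only if the derived symmetric group $(G_{m-2},r_{G_{m-2}})$ is nonabelian and satisfies lri.
   Context: A symmetric set is $(X,r)$, $r(x,y)=({}^xy,x^y)$ a non-degenerate (all $y\mapsto{}^xy$, $y\mapsto y^x$ bijective), involutive bijection of $X\times X$ with $r^{12}r^{23}r^{12}=r^{23}r^{12}r^{23}$ on $X^3$; square-free if $r(x,x)=(x,x)$; trivial if $r(x,y)=(y,x)$. $S(X,r)$, $G(X,r)$: monoid, group generated by $X$ with relations $xy=zt$ whenever $r(x,y)=(z,t)\ne(x,y)$. A symmetric group is $(G,\sigma)$, $\sigma(u,v)=({}^uv,u^v)$ involutive with ${}^a1=1,{}^1u=u,1^u=1,a^1=a$, ${}^{ab}u={}^a({}^bu)$, $a^{uv}=(a^u)^v$, ${}^a(uv)=({}^au)({}^{a^u}v)$, $(ab)^u=(a^{{}^bu})(b^u)$, $uv=({}^uv)(u^v)$; $(G,r_G)$ is $G(X,r)$ with the unique such braiding extending $r$; its left brace has $a+b:=a({}^{a^{-1}}b)$.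 $\mathcal{L}_a(b)={}^ab$. "Acts as automorphisms": ${}^a(bc)=({}^ab)({}^ac)$. lri: $({}^ab)^a=b={}^a(b^a)$ for all $a,b$. Raut: $(a+b)^c=a^c+b^c$. Retraction $\mathrm{Ret}(X,r)$: $x\sim y$ iff ${}^xz={}^yz\ \forall z$, $r_{[X]}([x],[y])=([{}^xy],[x^y])$; $\mathrm{Ret}^j$ iterates; $\mathrm{mpl}=m$ iff $m$ minimal with $\mathrm{Ret}^m$ one element. Derived symmetric groups: $(G_j,r_{G_j})=$ the associated symmetric group of $\mathrm{Ret}^j(X,r)$, $j\ge0$. *)

theory Defs
  imports "HOL-Algebra.Group"
begin

text \<open>A map r on X x X, r(x,y) = (lact r x y, ract r x y), i.e. lact r x y is the left action
  of x on y and ract r x y is x raised to the right action of y.\<close>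

definition lact :: "('a \<times> 'a \<Rightarrow> 'a \<times> 'a) \<Rightarrow> 'a \<Rightarrow> 'a \<Rightarrow> 'a" where
  "lact r x y = fst (r (x, y))"

definition ract :: "('a \<times> 'a \<Rightarrow> 'a \<times> 'a) \<Rightarrow> 'a \<Rightarrow> 'a \<Rightarrow> 'a" where
  "ract r x y = snd (r (x, y))"

definition r12 :: "('a \<times> 'a \<Rightarrow> 'a \<times> 'a) \<Rightarrow> 'a \<times> 'a \<times> 'a \<Rightarrow> 'a \<times> 'a \<times> 'a" where
  "r12 r = (\<lambda>(x, y, z). (fst (r (x, y)), snd (r (x, y)), z))"

definition r23 :: "('a \<times> 'a \<Rightarrow> 'a \<times> 'a) \<Rightarrow> 'a \<times> 'a \<times> 'a \<Rightarrow> 'a \<times> 'a \<times> 'a" where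
  "r23 r = (\<lambda>(x, y, z). (x, fst (r (y, z)), snd (r (y, z))))"

definition symmetric_set :: "'a set \<Rightarrow> ('a \<times> 'a \<Rightarrow> 'a \<times> 'a) \<Rightarrow> bool" where
  "symmetric_set X r \<longleftrightarrow>
     (\<forall>x\<in>X. \<forall>y\<in>X. r (x, y) \<in> X \<times> X) \<and>
     (\<forall>x\<in>X. \<forall>y\<in>X. r (r (x, y)) = (x, y)) \<and>
     (\<forall>x\<in>X. bij_betw (lact r x) X X) \<and>
     (\<forall>x\<in>X. bij_betw (\<lambda>y. ract r y x) X X) \<and>
     (\<forall>x\<in>X. \<forall>y\<in>X. \<forall>z\<in>X.
        r12 r (r23 r (r12 r (x, y, z))) = r23 r (r12 r (r23 r (x, y, z))))"

definition square_free :: "'a set \<Rightarrow> ('a \<times> 'a \<Rightarrow> 'a \<times> 'a) \<Rightarrow> bool" where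
  "square_free X r \<longleftrightarrow> (\<forall>x\<in>X. r (x, x) = (x, x))"

definition trivial_sol :: "'a set \<Rightarrow> ('a \<times> 'a \<Rightarrow> 'a \<times> 'a) \<Rightarrow> bool" where
  "trivial_sol X r \<longleftrightarrow> (\<forall>x\<in>X. \<forall>y\<in>X. r (x, y) = (y, x))"

text \<open>ret_rel X r j x y: the classes of x and y coincide in Ret^j(X,r).
  (Ret^{j+1} is the retraction of Ret^j, whose left action on classes is induced by that of X.)\<close>
fun ret_rel :: "'a set \<Rightarrow> ('a \<times> 'a \<Rightarrow> 'a \<times> 'a) \<Rightarrow> nat \<Rightarrow> 'a \<Rightarrow> 'a \<Rightarrow> bool" where
  "ret_rel X r 0 x y \<longleftrightarrow> x = y"
| "ret_rel X r (Suc j) x y \<longleftrightarrow> (\<forall>z\<in>X. ret_rel X r j (lact r x z) (lact r y z))"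

definition ret_class :: "'a set \<Rightarrow> ('a \<times> 'a \<Rightarrow> 'a \<times> 'a) \<Rightarrow> nat \<Rightarrow> 'a \<Rightarrow> 'a set" where
  "ret_class X r j x = {y\<in>X. ret_rel X r j x y}"

definition ret_set :: "'a set \<Rightarrow> ('a \<times> 'a \<Rightarrow> 'a \<times> 'a) \<Rightarrow> nat \<Rightarrow> 'a set set" where
  "ret_set X r j = ret_class X r j ` X"

definition ret_sol :: "'a set \<Rightarrow> ('a \<times> 'a \<Rightarrow> 'a \<times> 'a) \<Rightarrow> nat \<Rightarrow> 'a set \<times> 'a set \<Rightarrow> 'a set \<times> 'a set" where
  "ret_sol X r j = (\<lambda>(A, B). let x = (SOME x. x \<in> A); y = (SOME y. y \<in> B) in
      (ret_class X r j (lact r x y), ret_class X r j (ract r x y)))"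

definition ret_one :: "'a set \<Rightarrow> ('a \<times> 'a \<Rightarrow> 'a \<times> 'a) \<Rightarrow> nat \<Rightarrow> bool" where
  "ret_one X r m \<longleftrightarrow> card (ret_set X r m) = 1"

definition has_mpl :: "'a set \<Rightarrow> ('a \<times> 'a \<Rightarrow> 'a \<times> 'a) \<Rightarrow> nat \<Rightarrow> bool" where
  "has_mpl X r m \<longleftrightarrow> ret_one X r m \<and> (\<forall>k<m. \<not> ret_one X r k)"

text \<open>Words in X and its formal inverses: (x, True) is x, (x, False) is x^{-1}.\<close>
definition words_on :: "'a set \<Rightarrow> ('a \<times> bool) list set" where
  "words_on X = {w. \<forall>p\<in>set w. fst p \<in> X}"

inductive word_step :: "('a \<times> 'a \<Rightarrow> 'a \<times> 'a) \<Rightarrow> ('a \<times> bool) list \<Rightarrow> ('a \<times> bool) list \<Rightarrow> bool"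
  for r where
  cancel: "word_step r (u @ [(x, b), (x, \<not> b)] @ v) (u @ v)"
| braid: "word_step r (u @ [(x, True), (y, True)] @ v)
            (u @ [(fst (r (x, y)), True), (snd (r (x, y)), True)] @ v)"

definition word_eq :: "'a set \<Rightarrow> ('a \<times> 'a \<Rightarrow> 'a \<times> 'a) \<Rightarrow> (('a \<times> bool) list \<times> ('a \<times> bool) list) set" where
  "word_eq X r = Id_on (words_on X) \<union>
     {(w, w'). w \<in> words_on X \<and> w' \<in> words_on X \<and> (word_step r w w' \<or> word_step r w' w)}\<^sup>+"

definition struct_group :: "'a set \<Rightarrow> ('a \<times> 'a \<Rightarrow> 'a \<times> 'a) \<Rightarrow> ('a \<times> bool) list set monoid" where
  "struct_group X r =
     \<lparr>carrier = words_on X // word_eq X r,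
      mult = (\<lambda>A B. word_eq X r `` {(SOME a. a \<in> A) @ (SOME b. b \<in> B)}),
      one = word_eq X r `` {[]}\<rparr>"

definition struct_gen :: "'a set \<Rightarrow> ('a \<times> 'a \<Rightarrow> 'a \<times> 'a) \<Rightarrow> 'a \<Rightarrow> ('a \<times> bool) list set" where
  "struct_gen X r x = word_eq X r `` {[(x, True)]}"

inductive mon_step :: "('a \<times> 'a \<Rightarrow> 'a \<times> 'a) \<Rightarrow> 'a list \<Rightarrow> 'a list \<Rightarrow> bool" for r where
  "mon_step r (u @ [x, y] @ v) (u @ [fst (r (x, y)), snd (r (x, y))] @ v)"

definition mon_eq :: "'a set \<Rightarrow> ('a \<times> 'a \<Rightarrow> 'a \<times> 'a) \<Rightarrow> ('a list \<times> 'a list) set" where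
  "mon_eq X r = Id_on (lists X) \<union>
     {(w, w'). w \<in> lists X \<and> w' \<in> lists X \<and> (mon_step r w w' \<or> mon_step r w' w)}\<^sup>+"

definition S_embeds :: "'a set \<Rightarrow> ('a \<times> 'a \<Rightarrow> 'a \<times> 'a) \<Rightarrow> bool" where
  "S_embeds X r \<longleftrightarrow> (\<forall>w\<in>lists X. \<forall>w'\<in>lists X.
     word_eq X r `` {map (\<lambda>x. (x, True)) w} = word_eq X r `` {map (\<lambda>x. (x, True)) w'}
       \<longrightarrow> (w, w') \<in> mon_eq X r)"

definition symmetric_group :: "('g, 'm) monoid_scheme \<Rightarrow> ('g \<times> 'g \<Rightarrow> 'g \<times> 'g) \<Rightarrow> bool" where
  "symmetric_group G \<sigma> \<longleftrightarrow> group G \<and>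
     (\<forall>u\<in>carrier G. \<forall>v\<in>carrier G. \<sigma> (u, v) \<in> carrier G \<times> carrier G \<and> \<sigma> (\<sigma> (u, v)) = (u, v)) \<and>
     (\<forall>a\<in>carrier G. lact \<sigma> a \<one>\<^bsub>G\<^esub> = \<one>\<^bsub>G\<^esub> \<and> lact \<sigma> \<one>\<^bsub>G\<^esub> a = a \<and>
                     ract \<sigma> \<one>\<^bsub>G\<^esub> a = \<one>\<^bsub>G\<^esub> \<and> ract \<sigma> a \<one>\<^bsub>G\<^esub> = a) \<and>
     (\<forall>a\<in>carrier G. \<forall>b\<in>carrier G. \<forall>u\<in>carrier G. \<forall>v\<in>carrier G.
        lact \<sigma> (a \<otimes>\<^bsub>G\<^esub> b) u = lact \<sigma> a (lact \<sigma> b u) \<and>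
        ract \<sigma> a (u \<otimes>\<^bsub>G\<^esub> v) = ract \<sigma> (ract \<sigma> a u) v \<and>
        lact \<sigma> a (u \<otimes>\<^bsub>G\<^esub> v) = lact \<sigma> a u \<otimes>\<^bsub>G\<^esub> lact \<sigma> (ract \<sigma> a u) v \<and>
        ract \<sigma> (a \<otimes>\<^bsub>G\<^esub> b) u = ract \<sigma> a (lact \<sigma> b u) \<otimes>\<^bsub>G\<^esub> ract \<sigma> b u \<and>
        u \<otimes>\<^bsub>G\<^esub> v = lact \<sigma> u v \<otimes>\<^bsub>G\<^esub> ract \<sigma> u v)"

text \<open>r_G: the unique symmetric-group braiding on G(X,r) extending r (normalised to be the
  identity outside carrier x carrier so that it is a unique function).\<close>
definition assoc_braiding :: "'a set \<Rightarrow> ('a \<times> 'a \<Rightarrow> 'a \<times> 'a)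
    \<Rightarrow> ('a \<times> bool) list set \<times> ('a \<times> bool) list set \<Rightarrow> ('a \<times> bool) list set \<times> ('a \<times> bool) list set" where
  "assoc_braiding X r = (THE \<sigma>. symmetric_group (struct_group X r) \<sigma> \<and>
     (\<forall>x\<in>X. \<forall>y\<in>X. \<sigma> (struct_gen X r x, struct_gen X r y)
                    = (struct_gen X r (lact r x y), struct_gen X r (ract r x y))) \<and>
     (\<forall>p. p \<notin> carrier (struct_group X r) \<times> carrier (struct_group X r) \<longrightarrow> \<sigma> p = p))"

definition acts_as_automorphisms :: "('g, 'm) monoid_scheme \<Rightarrow> ('g \<times> 'g \<Rightarrow> 'g \<times> 'g) \<Rightarrow> bool" where
  "acts_as_automorphisms G \<sigma> \<longleftrightarrow> (\<forall>a\<in>carrier G. \<forall>b\<in>carrier G. \<forall>c\<in>carrier G.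
     lact \<sigma> a (b \<otimes>\<^bsub>G\<^esub> c) = lact \<sigma> a b \<otimes>\<^bsub>G\<^esub> lact \<sigma> a c)"

definition L_invariant :: "('g, 'm) monoid_scheme \<Rightarrow> ('g \<times> 'g \<Rightarrow> 'g \<times> 'g) \<Rightarrow> bool" where
  "L_invariant G \<sigma> \<longleftrightarrow> (\<forall>a\<in>carrier G. \<forall>b\<in>carrier G. \<forall>u\<in>carrier G.
     lact \<sigma> (lact \<sigma> b a) u = lact \<sigma> a u)"

definition lri :: "('g, 'm) monoid_scheme \<Rightarrow> ('g \<times> 'g \<Rightarrow> 'g \<times> 'g) \<Rightarrow> bool" where
  "lri G \<sigma> \<longleftrightarrow> (\<forall>a\<in>carrier G. \<forall>b\<in>carrier G.
     ract \<sigma> (lact \<sigma> a b) a = b \<and> lact \<sigma> a (ract \<sigma> b a) = b)"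

definition brace_add :: "('g, 'm) monoid_scheme \<Rightarrow> ('g \<times> 'g \<Rightarrow> 'g \<times> 'g) \<Rightarrow> 'g \<Rightarrow> 'g \<Rightarrow> 'g" where
  "brace_add G \<sigma> a b = a \<otimes>\<^bsub>G\<^esub> lact \<sigma> (inv\<^bsub>G\<^esub> a) b"

definition raut :: "('g, 'm) monoid_scheme \<Rightarrow> ('g \<times> 'g \<Rightarrow> 'g \<times> 'g) \<Rightarrow> bool" where
  "raut G \<sigma> \<longleftrightarrow> (\<forall>a\<in>carrier G. \<forall>b\<in>carrier G. \<forall>c\<in>carrier G.
     ract \<sigma> (brace_add G \<sigma> a b) c = brace_add G \<sigma> (ract \<sigma> a c) (ract \<sigma> b c))"

definition nonabelian :: "('g, 'm) monoid_scheme \<Rightarrow> bool" where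
  "nonabelian G \<longleftrightarrow> (\<exists>a\<in>carrier G. \<exists>b\<in>carrier G. a \<otimes>\<^bsub>G\<^esub> b \<noteq> b \<otimes>\<^bsub>G\<^esub> a)"

end

(* The structure group G acts on X, and sending the class of a word w to the sum of \<plusminus> e_(u.x) over all
  decompositions w = u x^{\<plusminus>1} v is a cocycle pi : G \<rightarrow> Z^(X).  It is a bijection: adding \<plusminus> e_x to the
  value of pi corresponds to commuting bijections g \<mapsto> g (g^{-1}.x)^{\<plusminus>1} of G.  Transporting the action
  along pi yields the unique braiding of G, and the brace addition is the addition of Z^(X).

  Square-freeness makes X itself satisfy lri, so the retraction relations are congruences and every
  Ret^j(X,r) is again square-free.  All conditions of (1) amount to L_{x.y} = L_y on X.  For lri and
  Raut this is seen on the element b = zzx with pi(b) = 2 e_z + e_q: comparing the coefficient 2 in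
  b^y = y^{-1}.b gives L_{b.y}^{-1} z = L_y^{-1} z, whence L_{x.y}^{-1} z = L_y^{-1} z for all z.
  Part (2) is part (1) for Ret^{m-2}(X,r), because G is abelian exactly if r is trivial. *)

theory Submission
  imports Defs
begin

section \<open>The retraction relations of an arbitrary map\<close>

lemma ret_rel_refl: "ret_rel X r j x x"
  by (induction j arbitrary: x) auto

lemma ret_rel_sym: "ret_rel X r j x y \<Longrightarrow> ret_rel X r j y x"
  by (induction j arbitrary: x y) auto

lemma ret_rel_trans: "ret_rel X r j x y \<Longrightarrow> ret_rel X r j y z \<Longrightarrow> ret_rel X r j x z"
proof (induction j arbitrary: x y z)
  case (Suc j)
  then show ?case
    unfolding ret_rel.simps by blast
qed simp

lemma ret_class_eq_iff:
  assumes "x \<in> X" "y \<in> X"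
  shows "ret_class X r j x = ret_class X r j y \<longleftrightarrow> ret_rel X r j x y"
  using assms ret_rel_refl ret_rel_sym ret_rel_trans unfolding ret_class_def by fast

text \<open>Empty and infinite sets both have \<open>card\<close> 0, so \<open>card = 1\<close>
  expresses faithfully that there is a single class.\<close>

lemma ret_one_iff:
  fixes X :: "'a set"
  shows "ret_one X r m \<longleftrightarrow> X \<noteq> {} \<and> (\<forall>x\<in>X. \<forall>y\<in>X. ret_rel X r m x y)"
proof -
  have *: "card (f ` A) = 1 \<longleftrightarrow> A \<noteq> {} \<and> (\<forall>x\<in>A. \<forall>y\<in>A. f x = f y)"
    for f :: "'a \<Rightarrow> 'a set" and A
  proof
    assume "card (f ` A) = 1"
    then obtain c where "f ` A = {c}"
      using card_1_singletonE by blast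
    then show "A \<noteq> {} \<and> (\<forall>x\<in>A. \<forall>y\<in>A. f x = f y)"
      by blast
  next
    assume A: "A \<noteq> {} \<and> (\<forall>x\<in>A. \<forall>y\<in>A. f x = f y)"
    then obtain a where "a \<in> A"
      by blast
    with A have "f ` A = {f a}"
      by blast
    then show "card (f ` A) = 1"
      by simp
  qed
  show ?thesis
    unfolding ret_one_def ret_set_def * using ret_class_eq_iff by metis
qed

section \<open>Square-free solutions and lri on \<open>X\<close>\<close>

locale sf_solution =
  fixes X :: "'a set" and r :: "'a \<times> 'a \<Rightarrow> 'a \<times> 'a"
  assumes sym_set: "symmetric_set X r" and sqfree: "square_free X r"
begin

abbreviation la (infixr "\<rhd>" 70) where "x \<rhd> y \<equiv> lact r x y"
abbreviation ra (infixl "\<lhd>" 70) where "x \<lhd> y \<equiv> ract r x y"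

lemma r_eq: "r (x, y) = (x \<rhd> y, x \<lhd> y)"
  by (simp add: lact_def ract_def)

lemma closed [simp, intro]:
  assumes "x \<in> X" "y \<in> X"
  shows "x \<rhd> y \<in> X" "x \<lhd> y \<in> X"
  using assms sym_set unfolding symmetric_set_def lact_def ract_def by (auto simp: mem_Times_iff)

lemma idem [simp]:
  assumes "x \<in> X"
  shows "x \<rhd> x = x" "x \<lhd> x = x"
  using assms sqfree unfolding square_free_def lact_def ract_def by auto

lemma invol:
  assumes "x \<in> X" "y \<in> X"
  shows "(x \<rhd> y) \<rhd> (x \<lhd> y) = x" "(x \<rhd> y) \<lhd> (x \<lhd> y) = y"
  using assms sym_set unfolding symmetric_set_def by (auto simp: r_eq)

lemma la_inj:
  assumes "x \<in> X" "y \<in> X" "z \<in> X" "x \<rhd> y = x \<rhd> z"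
  shows "y = z"
proof -
  have "inj_on (lact r x) X"
    using sym_set assms unfolding symmetric_set_def bij_betw_def by blast
  then show ?thesis
    using assms by (meson inj_onD)
qed

lemma ybe1:
  assumes "x \<in> X" "y \<in> X" "z \<in> X"
  shows "x \<rhd> y \<rhd> z = (x \<rhd> y) \<rhd> (x \<lhd> y) \<rhd> z"
proof -
  have "r12 r (r23 r (r12 r (x, y, z))) = r23 r (r12 r (r23 r (x, y, z)))"
    using sym_set assms unfolding symmetric_set_def by blast
  then show ?thesis
    by (simp add: r12_def r23_def r_eq)
qed

lemma ra_la_same:
  assumes "x \<in> X" "y \<in> X"
  shows "(x \<lhd> y) \<rhd> y = x \<rhd> y"
proof -
  \<comment> \<open>Square-freeness enters twice, for \<open>y\<close> and for
    \<open>x \<rhd> y\<close>; the operator of \<open>x \<rhd> y\<close> is then cancelled.\<close>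
  have "(x \<rhd> y) \<rhd> (x \<rhd> y) = (x \<rhd> y) \<rhd> (x \<lhd> y) \<rhd> y"
    using ybe1[of x y y] assms by simp
  then show ?thesis
    using la_inj assms by (metis closed)
qed

text \<open>This is \<open>ra_la_same\<close> at the pair r(x,y), rewritten by involutivity.
  Together with \<open>ra_la\<close> it makes the right action of each point of \<open>X\<close> the
  inverse of its left action.\<close>

lemma la_ra [simp]:
  assumes "x \<in> X" "y \<in> X"
  shows "y \<rhd> (x \<lhd> y) = x"
  using ra_la_same[of "x \<rhd> y" "x \<lhd> y"] invol[of x y] assms by simp

lemma ra_la [simp]:
  assumes "x \<in> X" "y \<in> X"
  shows "(y \<rhd> x) \<lhd> y = x"
  using la_ra[of "y \<rhd> x" y] la_inj assms by (metis closed)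

text \<open>Solve \<open>(x \<rhd> y) \<rhd> (x \<lhd> y) = x\<close> for \<open>x \<lhd> y\<close>
  by lri.\<close>

lemma ra_ra:
  assumes "x \<in> X" "y \<in> X"
  shows "x \<lhd> (x \<rhd> y) = x \<lhd> y"
  using invol(1)[of x y] assms by (metis closed ra_la)

lemma trivial_iff: "trivial_sol X r \<longleftrightarrow> (\<forall>x\<in>X. \<forall>y\<in>X. x \<rhd> y = y)"
  unfolding trivial_sol_def r_eq by (metis Pair_inject ra_la)

subsection \<open>Iterated retractions\<close>

lemma ret_rel_Suc: "ret_rel X r j x y \<Longrightarrow> ret_rel X r (Suc j) x y"
  by (induction j arbitrary: x y) (auto simp: ret_rel_refl)

lemma ret_one_mono:
  assumes "ret_one X r k" "k \<le> m"
  shows "ret_one X r m"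
  using assms(2,1) by (induction rule: dec_induct) (simp_all add: ret_one_iff ret_rel_Suc del: ret_rel.simps)

text \<open>Only the argument acted upon varies. Both actions share one induction, because the step
  for either of them uses both at level \<open>j\<close>.\<close>

lemma ret_rel_cong_arg:
  assumes "y \<in> X" "y' \<in> X" "z \<in> X" "ret_rel X r j y y'"
  shows "ret_rel X r j (z \<rhd> y) (z \<rhd> y')" "ret_rel X r j (y \<lhd> z) (y' \<lhd> z)"
proof -
  have "\<forall>y\<in>X. \<forall>y'\<in>X. \<forall>z\<in>X. ret_rel X r j y y' \<longrightarrow>
      ret_rel X r j (z \<rhd> y) (z \<rhd> y') \<and> ret_rel X r j (y \<lhd> z) (y' \<lhd> z)"
  proof (induction j)
    case 0
    show ?case by simp
  next
    case (Suc j)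
    let ?R = "ret_rel X r j"
    note [trans] = ret_rel_trans[of X r j]
    have IH: "?R (z \<rhd> y) (z \<rhd> y')" "?R (y \<lhd> z) (y' \<lhd> z)"
      if "y \<in> X" "y' \<in> X" "z \<in> X" "?R y y'" for y y' z
      using Suc that by blast+
    have op: "?R (y \<rhd> z) (y' \<rhd> z)" if "z \<in> X" "ret_rel X r (Suc j) y y'" for y y' z
      using that by simp
    have op': "?R (z \<lhd> y) (z \<lhd> y')"
      if "y \<in> X" "y' \<in> X" "z \<in> X" "ret_rel X r (Suc j) y y'" for y y' z
    proof -
      \<comment> \<open>The left side is \<open>z\<close> by lri; acting with \<open>y'\<close> from
        the right removes \<open>y'\<close> on the other side.\<close>
      have "?R (y \<rhd> (z \<lhd> y)) (y' \<rhd> (z \<lhd> y))"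
        using that by (intro op) auto
      then have "?R (z \<lhd> y') ((y' \<rhd> (z \<lhd> y)) \<lhd> y')"
        using that by (intro IH) auto
      then show ?thesis
        using that by (simp add: ret_rel_sym)
    qed
    show ?case
    proof (intro ballI impI)
      fix y y' z
      assume yz: "y \<in> X" "y' \<in> X" "z \<in> X" and yy: "ret_rel X r (Suc j) y y'"
      have r1: "?R ((z \<rhd> y) \<rhd> w) ((z \<rhd> y') \<rhd> w)" if w: "w \<in> X" for w
      proof -
        \<comment> \<open>The operator of \<open>z \<rhd> y\<close> is L_z L_y L_(z \<lhd> y)^{-1},
          so the change from \<open>y\<close> to \<open>y'\<close> can be traced factor by
          factor.\<close>
        have eq: "(z \<rhd> y) \<rhd> w = z \<rhd> y \<rhd> (w \<lhd> (z \<lhd> y))" if "y \<in> X" for y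
          using ybe1[of z y "w \<lhd> (z \<lhd> y)"] yz w that by simp
        \<comment> \<open>The inner \<open>op'\<close> relates \<open>z \<lhd> y\<close> and
          \<open>z \<lhd> y'\<close> at level \<open>j\<close>; \<open>ret_rel_Suc\<close> lifts
          this one level, so that \<open>op'\<close> applies again.\<close>
        have "?R (w \<lhd> (z \<lhd> y)) (w \<lhd> (z \<lhd> y'))"
          using yz w by (intro op' ret_rel_Suc op' yy) auto
        then have "?R (y \<rhd> (w \<lhd> (z \<lhd> y))) (y \<rhd> (w \<lhd> (z \<lhd> y')))"
          using yz w by (intro IH) auto
        also have "?R \<dots> (y' \<rhd> (w \<lhd> (z \<lhd> y')))"
          using yz w by (intro op yy) auto
        finally show ?thesis
          using yz w by (simp add: eq IH)
      qed
      have r2: "?R ((y \<lhd> z) \<rhd> w) ((y' \<lhd> z) \<rhd> w)" if w: "w \<in> X" for w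
      proof -
        \<comment> \<open>The braid relation solved for the operator of \<open>y \<lhd> z\<close>:
          it is L_z^{-1} L_y L_(z \<lhd> y).\<close>
        have eq: "(y \<lhd> z) \<rhd> w = (y \<rhd> (z \<lhd> y) \<rhd> w) \<lhd> z" if "y \<in> X" for y
        proof -
          have "z \<rhd> (y \<lhd> z) \<rhd> w = y \<rhd> (z \<lhd> y) \<rhd> w"
            using ybe1[of z "y \<lhd> z" w] ra_ra[of z "y \<lhd> z"] yz w that by simp
          then show ?thesis
            using yz w that by (metis closed ra_la)
        qed
        have "?R ((z \<lhd> y) \<rhd> w) ((z \<lhd> y') \<rhd> w)"
          using yz w by (intro op ret_rel_Suc op' yy) auto
        then have "?R (y \<rhd> (z \<lhd> y) \<rhd> w) (y \<rhd> (z \<lhd> y') \<rhd> w)"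
          using yz w by (intro IH) auto
        also have "?R \<dots> (y' \<rhd> (z \<lhd> y') \<rhd> w)"
          using yz w by (intro op yy) auto
        finally show ?thesis
          using yz w by (simp add: eq IH)
      qed
      show "ret_rel X r (Suc j) (z \<rhd> y) (z \<rhd> y') \<and> ret_rel X r (Suc j) (y \<lhd> z) (y' \<lhd> z)"
        using r1 r2 by simp
    qed
  qed
  then show "ret_rel X r j (z \<rhd> y) (z \<rhd> y')" "ret_rel X r j (y \<lhd> z) (y' \<lhd> z)"
    using assms by blast+
qed

lemma ret_rel_cong:
  assumes "x \<in> X" "x' \<in> X" "y \<in> X" "y' \<in> X" "ret_rel X r j x x'" "ret_rel X r j y y'"
  shows "ret_rel X r j (x \<rhd> y) (x' \<rhd> y')" "ret_rel X r j (x \<lhd> y) (x' \<lhd> y')"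
proof -
  show "ret_rel X r j (x \<rhd> y) (x' \<rhd> y')"
    using assms ret_rel_cong_arg(1)[of y y' x j] ret_rel_Suc[of j x x'] ret_rel_trans
    by (metis ret_rel.simps(2))
  have "ret_rel X r j (y \<rhd> (x \<lhd> y)) (y' \<rhd> (x \<lhd> y))"
    using ret_rel_Suc[OF assms(6)] assms(1,3) unfolding ret_rel.simps by blast
  then have "ret_rel X r j (x \<lhd> y') (x \<lhd> y)"
    using ret_rel_cong_arg(2)[of x "y' \<rhd> (x \<lhd> y)" y' j] assms by simp
  moreover have "ret_rel X r j (x \<lhd> y') (x' \<lhd> y')"
    using ret_rel_cong_arg(2) assms by blast
  ultimately show "ret_rel X r j (x \<lhd> y) (x' \<lhd> y')"
    using ret_rel_sym ret_rel_trans by metis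
qed

text \<open>The representatives come from a choice operator; \<open>ret_rel_cong\<close> makes the
  result independent of them.\<close>

lemma ret_sol_class:
  assumes "x \<in> X" "y \<in> X"
  shows "ret_sol X r j (ret_class X r j x, ret_class X r j y)
    = (ret_class X r j (x \<rhd> y), ret_class X r j (x \<lhd> y))"
proof -
  have some: "(SOME a. a \<in> ret_class X r j x) \<in> X \<and>
      ret_rel X r j x (SOME a. a \<in> ret_class X r j x)" if "x \<in> X" for x
  proof -
    have "x \<in> ret_class X r j x"
      using that by (simp add: ret_class_def ret_rel_refl)
    then have "(SOME a. a \<in> ret_class X r j x) \<in> ret_class X r j x"
      by (rule someI)
    then show ?thesis
      by (simp add: ret_class_def)
  qed
  show ?thesis
    using some[OF assms(1)] some[OF assms(2)] assms
    by (simp add: ret_sol_def Let_def ret_class_eq_iff ret_rel_cong ret_rel_sym)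
qed

lemma ret_lact_class:
  assumes "x \<in> X" "y \<in> X"
  shows "lact (ret_sol X r j) (ret_class X r j x) (ret_class X r j y) = ret_class X r j (x \<rhd> y)"
    and "ract (ret_sol X r j) (ret_class X r j x) (ret_class X r j y) = ret_class X r j (x \<lhd> y)"
  using ret_sol_class[OF assms] by (simp_all add: lact_def[of "ret_sol X r j"] ract_def[of "ret_sol X r j"])

text \<open>Identities pass to classes, but injectivity of the translations does not do so by
  itself. It is saved by lri, which exhibits the two actions as mutually inverse.\<close>

lemma sf_solution_ret: "sf_solution (ret_set X r j) (ret_sol X r j)"
proof
  let ?c = "ret_class X r j" and ?s = "ret_sol X r j"
  have ball: "(\<forall>A\<in>ret_set X r j. P A) \<longleftrightarrow> (\<forall>x\<in>X. P (?c x))" for P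
    by (simp add: ret_set_def)
  have cin: "?c x \<in> ret_set X r j" if "x \<in> X" for x
    using that by (simp add: ret_set_def)
  have b1: "bij_betw (lact ?s (?c x)) (ret_set X r j) (ret_set X r j)" if "x \<in> X" for x
    by (rule bij_betw_byWitness[where f' = "\<lambda>A. ract ?s A (?c x)"])
      (use that in \<open>auto simp: ball ret_lact_class cin image_subset_iff\<close>)
  have b2: "bij_betw (\<lambda>A. ract ?s A (?c x)) (ret_set X r j) (ret_set X r j)" if "x \<in> X" for x
    by (rule bij_betw_byWitness[where f' = "lact ?s (?c x)"])
      (use that in \<open>auto simp: ball ret_lact_class cin image_subset_iff\<close>)
  have ybe: "r12 ?s (r23 ?s (r12 ?s (?c x, ?c y, ?c z))) = r23 ?s (r12 ?s (r23 ?s (?c x, ?c y, ?c z)))"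
    if "x \<in> X" "y \<in> X" "z \<in> X" for x y z
  proof -
    have "r12 r (r23 r (r12 r (x, y, z))) = r23 r (r12 r (r23 r (x, y, z)))"
      using sym_set that unfolding symmetric_set_def by blast
    then show ?thesis
      using that by (simp add: r12_def r23_def r_eq ret_sol_class)
  qed
  show "symmetric_set (ret_set X r j) ?s"
    unfolding symmetric_set_def using b1 b2 ybe
    by (simp add: ball ret_sol_class cin invol)
  show "square_free (ret_set X r j) ?s"
    unfolding square_free_def by (simp add: ball ret_sol_class)
qed

text \<open>At \<open>k = 0\<close> equality of classes is the relation of level \<open>j\<close> on
  \<open>X\<close>; each further level only adds a left translation on both sides.\<close>

lemma ret_rel_ret:
  assumes "x \<in> X" "y \<in> X"
  shows "ret_rel (ret_set X r j) (ret_sol X r j) k (ret_class X r j x) (ret_class X r j y)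
    \<longleftrightarrow> ret_rel X r (j + k) x y"
  using assms
  by (induction k arbitrary: x y) (simp_all add: ret_class_eq_iff ret_set_def ret_lact_class)

lemma ret_one_ret: "ret_one (ret_set X r j) (ret_sol X r j) k \<longleftrightarrow> ret_one X r (j + k)"
  unfolding ret_one_iff by (auto simp: ret_set_def ret_rel_ret[unfolded ret_set_def])

subsection \<open>The structure group\<close>

abbreviation "W \<equiv> words_on X"
abbreviation "G \<equiv> struct_group X r"
abbreviation "gen \<equiv> struct_gen X r"

definition word_class :: "('a \<times> bool) list \<Rightarrow> ('a \<times> bool) list set" where
  "word_class w = word_eq X r `` {w}"

lemma words_on_simps [simp]:
  "[] \<in> W" "p # w \<in> W \<longleftrightarrow> fst p \<in> X \<and> w \<in> W" "u @ v \<in> W \<longleftrightarrow> u \<in> W \<and> v \<in> W"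
  by (auto simp: words_on_def)

text \<open>Reduces well-definedness on classes to invariance under one rewriting step.\<close>

lemma word_eq_induct [consumes 1, case_names refl step sym trans]:
  assumes "(w, w') \<in> word_eq X r"
    and "\<And>w. w \<in> W \<Longrightarrow> P w w"
    and step: "\<And>w w'. w \<in> W \<Longrightarrow> w' \<in> W \<Longrightarrow> word_step r w w' \<Longrightarrow> P w w'"
    and sym: "\<And>w w'. P w w' \<Longrightarrow> P w' w"
    and trans: "\<And>u v w. P u v \<Longrightarrow> P v w \<Longrightarrow> P u w"
  shows "P w w'"
proof -
  have "P w w'"
    if "(w, w') \<in> {(w, w'). w \<in> W \<and> w' \<in> W \<and> (word_step r w w' \<or> word_step r w' w)}\<^sup>+"
    using that
  proof (induction rule: trancl_induct)
    case (base w')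
    then show ?case using step sym by blast
  next
    case (step u v)
    then show ?case using assms(3) sym trans by blast
  qed
  then show ?thesis
    using assms(1,2) unfolding word_eq_def by blast
qed

lemma word_eq_in_words: "(w, w') \<in> word_eq X r \<Longrightarrow> w \<in> W \<and> w' \<in> W"
  by (induction rule: word_eq_induct) auto

lemma word_eq_refl: "w \<in> W \<Longrightarrow> (w, w) \<in> word_eq X r"
  by (auto simp: word_eq_def)

lemma word_eq_step: "w \<in> W \<Longrightarrow> w' \<in> W \<Longrightarrow> word_step r w w' \<Longrightarrow> (w, w') \<in> word_eq X r"
  by (auto simp: word_eq_def)

lemma word_eq_trans: "(u, v) \<in> word_eq X r \<Longrightarrow> (v, w) \<in> word_eq X r \<Longrightarrow> (u, w) \<in> word_eq X r"
  unfolding word_eq_def by (auto intro: trancl_trans)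

lemma word_eq_sym: "(u, v) \<in> word_eq X r \<Longrightarrow> (v, u) \<in> word_eq X r"
proof -
  let ?S = "{(w, w'). w \<in> W \<and> w' \<in> W \<and> (word_step r w w' \<or> word_step r w' w)}"
  have "sym (?S\<^sup>+)"
    by (rule sym_trancl) (auto simp: sym_def)
  then show "(u, v) \<in> word_eq X r \<Longrightarrow> (v, u) \<in> word_eq X r"
    unfolding word_eq_def sym_def by blast
qed

lemma word_class_eq_iff:
  assumes "u \<in> W" "v \<in> W"
  shows "word_class u = word_class v \<longleftrightarrow> (u, v) \<in> word_eq X r"
  using assms word_eq_refl word_eq_sym word_eq_trans unfolding word_class_def by blast

lemma word_step_context: "word_step r w w' \<Longrightarrow> word_step r (u @ w @ v) (u @ w' @ v)"
proof (induction rule: word_step.induct)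
  case (cancel p x b q)
  show ?case
    using word_step.cancel[of r "u @ p" x b "q @ v"] by simp
next
  case (braid p x y q)
  show ?case
    using word_step.braid[of r "u @ p" x y "q @ v"] by simp
qed

lemma word_eq_context:
  assumes "(w, w') \<in> word_eq X r" "u \<in> W" "v \<in> W"
  shows "(u @ w @ v, u @ w' @ v) \<in> word_eq X r"
  using assms(1)
proof (induction rule: word_eq_induct)
  case (refl w)
  then show ?case using assms by (simp add: word_eq_refl)
next
  case (step w w')
  then show ?case using assms by (simp add: word_eq_step word_step_context)
qed (blast intro: word_eq_sym word_eq_trans)+

lemma word_eq_append:
  assumes "(u, u') \<in> word_eq X r" "(v, v') \<in> word_eq X r"
  shows "(u @ v, u' @ v') \<in> word_eq X r"
  using word_eq_context[OF assms(1), of "[]" v] word_eq_context[OF assms(2), of u' "[]"]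
    word_eq_in_words[OF assms(1)] word_eq_in_words[OF assms(2)] word_eq_trans by simp

lemma carrier_eq: "carrier G = word_class ` W"
  by (auto simp: struct_group_def quotient_def word_class_def)

lemma one_eq: "\<one>\<^bsub>G\<^esub> = word_class []"
  by (simp add: struct_group_def word_class_def)

lemma some_word_class:
  assumes "w \<in> W"
  shows "(w, SOME v. v \<in> word_class w) \<in> word_eq X r"
proof -
  have "w \<in> word_class w"
    using assms by (simp add: word_class_def word_eq_refl)
  then have "(SOME v. v \<in> word_class w) \<in> word_class w"
    by (rule someI)
  then show ?thesis
    by (simp add: word_class_def)
qed

lemma mult_eq:
  assumes "u \<in> W" "v \<in> W"
  shows "word_class u \<otimes>\<^bsub>G\<^esub> word_class v = word_class (u @ v)"
proof -
  have "(u @ v, (SOME a. a \<in> word_class u) @ (SOME a. a \<in> word_class v)) \<in> word_eq X r"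
    using assms by (intro word_eq_append some_word_class)
  then have "word_class (u @ v) = word_class ((SOME a. a \<in> word_class u) @ (SOME a. a \<in> word_class v))"
    using word_class_eq_iff word_eq_in_words by blast
  then show ?thesis
    by (simp add: struct_group_def word_class_def)
qed

lemma word_class_cancel: "x \<in> X \<Longrightarrow> word_class [(x, b), (x, \<not> b)] = word_class []"
  using word_step.cancel[of r "[]" x b "[]"] by (simp add: word_class_eq_iff word_eq_step)

lemma word_class_braid:
  "x \<in> X \<Longrightarrow> y \<in> X \<Longrightarrow> word_class [(x, True), (y, True)] = word_class [(x \<rhd> y, True), (x \<lhd> y, True)]"
  using word_step.braid[of r "[]" x y "[]"] by (simp add: word_class_eq_iff word_eq_step r_eq)

lemma group_G: "group G"
proof (rule groupI)
  fix g assume "g \<in> carrier G"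
  then obtain w where w: "w \<in> W" "g = word_class w"
    by (auto simp: carrier_eq)
  \<comment> \<open>The inverse word grows at its end: the inverse of the first letter is appended
    to an inverse of the rest.\<close>
  have "\<exists>v\<in>W. word_class v \<otimes>\<^bsub>G\<^esub> word_class w = word_class []"
    using w(1)
  proof (induction w)
    case Nil
    show ?case
      using mult_eq[of "[]" "[]"] by force
  next
    case (Cons p w)
    then obtain v where v: "v \<in> W" "word_class v \<otimes>\<^bsub>G\<^esub> word_class w = word_class []"
      by auto
    obtain x b where p: "p = (x, b)"
      by (cases p)
    have x: "x \<in> X" "w \<in> W"
      using Cons.prems p by auto
    have "word_class (v @ [(x, \<not> b)]) \<otimes>\<^bsub>G\<^esub> word_class (p # w) = word_class (v @ [(x, \<not> b), (x, b)] @ w)"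
      using x v p by (simp add: mult_eq)
    also have "\<dots> = word_class v \<otimes>\<^bsub>G\<^esub> (word_class [(x, \<not> b), (x, b)] \<otimes>\<^bsub>G\<^esub> word_class w)"
      using x v by (simp add: mult_eq)
    also have "\<dots> = word_class []"
      using x v word_class_cancel[of x "\<not> b"] by (simp add: mult_eq)
    finally show ?case
      using v x by (intro bexI[of _ "v @ [(x, \<not> b)]"]) auto
  qed
  then show "\<exists>h\<in>carrier G. h \<otimes>\<^bsub>G\<^esub> g = \<one>\<^bsub>G\<^esub>"
    using w by (auto simp: carrier_eq one_eq)
qed (auto simp: carrier_eq one_eq mult_eq)

sublocale G: group G
  by (rule group_G)

abbreviation gmult (infixl "\<cdot>" 75) where "g \<cdot> h \<equiv> g \<otimes>\<^bsub>G\<^esub> h"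
abbreviation ginv where "ginv g \<equiv> inv\<^bsub>G\<^esub> g"

lemma gen_eq: "gen x = word_class [(x, True)]"
  by (simp add: struct_gen_def word_class_def)

lemma gen_closed [simp]: "x \<in> X \<Longrightarrow> gen x \<in> carrier G"
  by (simp add: gen_eq carrier_eq)

lemma inv_gen: "x \<in> X \<Longrightarrow> ginv (gen x) = word_class [(x, False)]"
  using word_class_cancel[of x False]
  by (intro G.inv_equality) (simp_all add: gen_eq carrier_eq mult_eq one_eq)

lemma gen_braid: "x \<in> X \<Longrightarrow> y \<in> X \<Longrightarrow> gen x \<cdot> gen y = gen (x \<rhd> y) \<cdot> gen (x \<lhd> y)"
  using word_class_braid[of x y] by (simp add: gen_eq mult_eq)

text \<open>Letters are appended on the right, since right multiplication by a letter is what adds a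
  basis vector to the cocycle.\<close>

lemma G_induct [consumes 1, case_names one gen inv]:
  assumes "g \<in> carrier G" "P \<one>\<^bsub>G\<^esub>"
    and "\<And>g x. g \<in> carrier G \<Longrightarrow> x \<in> X \<Longrightarrow> P g \<Longrightarrow> P (g \<cdot> gen x)"
    and "\<And>g x. g \<in> carrier G \<Longrightarrow> x \<in> X \<Longrightarrow> P g \<Longrightarrow> P (g \<cdot> ginv (gen x))"
  shows "P g"
proof -
  obtain w where w: "w \<in> W" "g = word_class w"
    using assms(1) by (auto simp: carrier_eq)
  have "P (word_class w)"
    using w(1)
  proof (induction w rule: rev_induct)
    case Nil
    show ?case using assms(2) by (simp add: one_eq)
  next
    case (snoc p w)
    obtain x b where p: "p = (x, b)"
      by (cases p)
    have x: "x \<in> X" "w \<in> W" "word_class w \<in> carrier G" "P (word_class w)"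
      using snoc p by (auto simp: carrier_eq)
    have "word_class (w @ [p]) = word_class w \<cdot> (if b then gen x else ginv (gen x))"
      using x p by (cases b) (simp_all add: mult_eq inv_gen gen_eq[of x, symmetric], simp add: mult_eq gen_eq)
    then show ?case
      using assms(3,4)[OF x(3,1,4)] by (cases b) simp_all
  qed
  then show ?thesis using w by simp
qed

subsection \<open>The action on generators and the cocycle\<close>

text \<open>Letters act by the identity outside of \<open>X\<close>, so that they are permutations of the whole type.\<close>

definition letter_act :: "'a \<times> bool \<Rightarrow> 'a \<Rightarrow> 'a" where
  "letter_act p z = (if z \<in> X then if snd p then fst p \<rhd> z else z \<lhd> fst p else z)"

fun word_act :: "('a \<times> bool) list \<Rightarrow> 'a \<Rightarrow> 'a" where
  "word_act [] z = z"
| "word_act (p # w) z = letter_act p (word_act w z)"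

fun word_inv_act :: "('a \<times> bool) list \<Rightarrow> 'a \<Rightarrow> 'a" where
  "word_inv_act [] z = z"
| "word_inv_act (p # w) z = word_inv_act w (letter_act (fst p, \<not> snd p) z)"

text \<open>The coefficient at \<open>z\<close> of the sum of \<plusminus> e_(u.x): instead of
  moving \<open>x\<close> by the prefix u, the recursion moves \<open>z\<close> by the inverse of
  u.\<close>

fun word_pi :: "('a \<times> bool) list \<Rightarrow> 'a \<Rightarrow> int" where
  "word_pi [] z = 0"
| "word_pi (p # w) z = (if z = fst p then if snd p then 1 else - 1 else 0)
     + word_pi w (letter_act (fst p, \<not> snd p) z)"

lemma letter_act_inverse [simp]:
  "x \<in> X \<Longrightarrow> letter_act (x, b) (letter_act (x, \<not> b) z) = z"
  "x \<in> X \<Longrightarrow> letter_act (x, \<not> b) (letter_act (x, b) z) = z"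
  by (auto simp: letter_act_def)

lemma letter_act_same: "x \<in> X \<Longrightarrow> letter_act (x, b) x = x"
  by (auto simp: letter_act_def)

lemma letter_act_closed: "x \<in> X \<Longrightarrow> letter_act (x, b) z \<in> X \<longleftrightarrow> z \<in> X"
  by (auto simp: letter_act_def)

lemma word_act_append: "word_act (u @ v) z = word_act u (word_act v z)"
  by (induction u) auto

lemma word_act_closed: "w \<in> W \<Longrightarrow> word_act w z \<in> X \<longleftrightarrow> z \<in> X"
  by (induction w) (auto simp: letter_act_closed)

lemma word_inv_act_act: "w \<in> W \<Longrightarrow> word_inv_act w (word_act w z) = z"
  by (induction w arbitrary: z) auto

lemma word_pi_append: "word_pi (u @ v) z = word_pi u z + word_pi v (word_inv_act u z)"
  by (induction u arbitrary: z) auto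

text \<open>The inverse of \<open>ybe1\<close>, needed because \<open>word_pi\<close> moves its
  argument by inverse letters.\<close>

lemma ra_ybe:
  assumes "x \<in> X" "y \<in> X" "z \<in> X"
  shows "z \<lhd> (x \<rhd> y) \<lhd> (x \<lhd> y) = z \<lhd> x \<lhd> y"
proof -
  have "z = (x \<rhd> y) \<rhd> (x \<lhd> y) \<rhd> (z \<lhd> x \<lhd> y)"
    using ybe1[of x y "z \<lhd> x \<lhd> y"] assms by simp
  then show ?thesis
    using assms by (metis closed ra_la)
qed

lemma word_step_act:
  assumes "word_step r w w'" "w \<in> W"
  shows "word_act w z = word_act w' z"
  using assms
proof (induction arbitrary: z)
  case (cancel u x b v)
  then show ?case by (simp add: word_act_append)
next
  case (braid u x y v)
  then show ?case
    using ybe1[of x y "word_act v z"]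
    by (auto simp: word_act_append word_act_closed letter_act_def r_eq)
qed

text \<open>A cancelling pair contributes e_x with both signs, as \<open>x\<close> fixes itself.
  Both sides of a braid step contribute e_x and e_(x \<rhd> y), in opposite orders, by
  involutivity.\<close>

lemma word_step_pi:
  assumes "word_step r w w'" "w \<in> W"
  shows "word_pi w z = word_pi w' z"
  using assms
proof (induction arbitrary: z)
  case (cancel u x b v)
  have "letter_act (x, \<not> b) t = x \<longleftrightarrow> t = x" for t
    using cancel letter_act_inverse(1)[of x b t] letter_act_same[of x] by fastforce
  then show ?case using cancel by (simp add: word_pi_append)
next
  case (braid u x y v)
  have xy: "x \<in> X" "y \<in> X"
    using braid by auto
  have "word_pi ([(x, True), (y, True)] @ v) t = word_pi ([(x \<rhd> y, True), (x \<lhd> y, True)] @ v) t" for t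
  proof (cases "t \<in> X")
    case True
    have "t \<lhd> x = y \<longleftrightarrow> t = x \<rhd> y"
      using xy True by (metis la_ra ra_la)
    moreover have "t \<lhd> (x \<rhd> y) = x \<lhd> y \<longleftrightarrow> t = x"
      using xy True invol by (metis closed la_ra ra_la)
    ultimately show ?thesis
      using xy True ra_ybe[of x y t] by (simp add: letter_act_def)
  next
    case False
    then show ?thesis using xy by (auto simp: letter_act_def)
  qed
  then show ?case by (simp add: word_pi_append r_eq)
qed

section \<open>Descent of the action and the cocycle to the group\<close>

definition gact :: "('a \<times> bool) list set \<Rightarrow> 'a \<Rightarrow> 'a" where
  "gact g = word_act (SOME w. w \<in> g)"

definition gpi :: "('a \<times> bool) list set \<Rightarrow> 'a \<Rightarrow> int" where
  "gpi g = word_pi (SOME w. w \<in> g)"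

lemma gact_class:
  assumes "w \<in> W"
  shows "gact (word_class w) z = word_act w z"
proof -
  have "word_act w z = word_act w' z" if "(w, w') \<in> word_eq X r" for w w'
    using that by (induction rule: word_eq_induct) (auto simp: word_step_act)
  then show ?thesis
    using some_word_class[OF assms] by (simp add: gact_def)
qed

lemma gpi_class:
  assumes "w \<in> W"
  shows "gpi (word_class w) z = word_pi w z"
proof -
  have "word_pi w z = word_pi w' z" if "(w, w') \<in> word_eq X r" for w w'
    using that by (induction rule: word_eq_induct) (auto simp: word_step_pi)
  then show ?thesis
    using some_word_class[OF assms] by (simp add: gpi_def)
qed

lemma gact_one [simp]: "gact \<one>\<^bsub>G\<^esub> z = z"
  by (simp add: one_eq gact_class)

lemma gact_mult [simp]:
  "g \<in> carrier G \<Longrightarrow> h \<in> carrier G \<Longrightarrow> gact (g \<cdot> h) z = gact g (gact h z)"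
  by (auto simp: carrier_eq mult_eq gact_class word_act_append)

lemma gact_closed [simp]: "g \<in> carrier G \<Longrightarrow> gact g z \<in> X \<longleftrightarrow> z \<in> X"
  by (auto simp: carrier_eq gact_class word_act_closed)

lemma gact_gen [simp]: "x \<in> X \<Longrightarrow> z \<in> X \<Longrightarrow> gact (gen x) z = x \<rhd> z"
  by (simp add: gen_eq gact_class letter_act_def)

lemma gact_inv_gen [simp]: "x \<in> X \<Longrightarrow> z \<in> X \<Longrightarrow> gact (ginv (gen x)) z = z \<lhd> x"
  by (simp add: inv_gen gact_class letter_act_def)

lemma gact_inverse [simp]:
  assumes "g \<in> carrier G"
  shows "gact (ginv g) (gact g z) = z" "gact g (gact (ginv g) z) = z"
  using assms by (simp_all flip: gact_mult)

lemma word_act_outside: "z \<notin> X \<Longrightarrow> word_act w z = z"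
  by (induction w) (auto simp: letter_act_def)

lemma gact_outside: "g \<in> carrier G \<Longrightarrow> z \<notin> X \<Longrightarrow> gact g z = z"
  by (auto simp: carrier_eq gact_class word_act_outside)

lemma gpi_one [simp]: "gpi \<one>\<^bsub>G\<^esub> z = 0"
  by (simp add: one_eq gpi_class)

lemma gpi_mult:
  assumes "g \<in> carrier G" "h \<in> carrier G"
  shows "gpi (g \<cdot> h) z = gpi g z + gpi h (gact (ginv g) z)"
proof -
  obtain u v where uv: "u \<in> W" "v \<in> W" "g = word_class u" "h = word_class v"
    using assms by (auto simp: carrier_eq)
  have "z = word_act u (gact (ginv g) z)"
    using gact_inverse(2)[OF assms(1), of z] gact_class[OF uv(1)] unfolding uv(3) by simp
  then have "gact (ginv g) z = word_inv_act u z"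
    using word_inv_act_act[OF uv(1), of "gact (ginv g) z"] by simp
  then show ?thesis
    unfolding uv(3,4) using uv(1,2) by (simp add: mult_eq gpi_class word_pi_append)
qed

lemma gpi_gen [simp]: "x \<in> X \<Longrightarrow> gpi (gen x) z = (if z = x then 1 else 0)"
  by (simp add: gen_eq gpi_class)

lemma gpi_inv_gen [simp]: "x \<in> X \<Longrightarrow> gpi (ginv (gen x)) z = (if z = x then - 1 else 0)"
  by (simp add: inv_gen gpi_class)

subsection \<open>Injectivity of the cocycle\<close>

text \<open>Adds the basis vector \<open>\<plusminus> x\<close> to the value of the cocycle at \<open>g\<close>.\<close>

definition shift :: "'a \<times> bool \<Rightarrow> ('a \<times> bool) list set \<Rightarrow> ('a \<times> bool) list set" where
  "shift p g = (let y = gact (ginv g) (fst p) in g \<cdot> (if snd p then gen y else ginv (gen y)))"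

lemma shift_closed [simp]: "g \<in> carrier G \<Longrightarrow> x \<in> X \<Longrightarrow> shift (x, b) g \<in> carrier G"
  by (simp add: shift_def Let_def)

lemma mult_gen_eq_shift:
  assumes "g \<in> carrier G" "x \<in> X"
  shows "g \<cdot> gen x = shift (gact g x, True) g" "g \<cdot> ginv (gen x) = shift (gact g x, False) g"
  using assms by (simp_all add: shift_def)

lemma G_induct_shift [consumes 1, case_names one shift]:
  assumes "g \<in> carrier G" "P \<one>\<^bsub>G\<^esub>"
    and "\<And>g x b. g \<in> carrier G \<Longrightarrow> x \<in> X \<Longrightarrow> P g \<Longrightarrow> P (shift (x, b) g)"
  shows "P g"
  using assms(1)
proof (induction g rule: G_induct)
  case one
  show ?case by (rule assms(2))
qed (simp_all add: mult_gen_eq_shift assms(3))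

lemma gpi_shift:
  assumes "g \<in> carrier G" "x \<in> X"
  shows "gpi (shift (x, b) g) z = gpi g z + (if z = x then if b then 1 else - 1 else 0)"
proof -
  have "gact (ginv g) z = gact (ginv g) x \<longleftrightarrow> z = x"
    using assms gact_inverse(2) by metis
  then show ?thesis
    using assms by (simp add: shift_def Let_def gpi_mult)
qed

text \<open>Put y = g^{-1}.x. As y fixes itself, the shifted element still carries y to x, so the
  second shift multiplies by the inverse letter.\<close>

lemma shift_inverse:
  assumes "g \<in> carrier G" "x \<in> X"
  shows "shift (x, \<not> b) (shift (x, b) g) = g"
  using assms
  by (cases b) (simp_all add: shift_def Let_def G.inv_mult_group G.m_assoc)

lemma shift_commute_pos:
  assumes g: "g \<in> carrier G" and "x \<in> X" "y \<in> X"
  shows "shift (x, True) (shift (y, True) g) = shift (y, True) (shift (x, True) g)"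
proof -
  define u v where "u = gact (ginv g) y" and "v = gact (ginv g) x"
  have uv: "u \<in> X" "v \<in> X"
    using assms by (simp_all add: u_def v_def)
  \<comment> \<open>After multiplication by \<open>g\<close> the left side is the shift by
    \<open>y\<close> and then \<open>x\<close>, the right side the one in the other order. They
    agree by the braid relation of \<open>X\<close>.\<close>
  have "gen u \<cdot> gen (v \<lhd> u) = gen v \<cdot> gen (u \<lhd> v)"
    using gen_braid[of u "v \<lhd> u"] ra_ra[of u "v \<lhd> u"] uv by simp
  then show ?thesis
    using uv g
    by (simp add: shift_def Let_def G.inv_mult_group G.m_assoc flip: u_def v_def)
qed

text \<open>A map commuting with a bijection commutes with its inverse; \<open>flip\<close> applies
  this to one sign at a time.\<close>

lemma shift_commute:
  assumes g: "g \<in> carrier G" and "x \<in> X" "y \<in> X"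
  shows "shift (x, b) (shift (y, c) g) = shift (y, c) (shift (x, b) g)"
proof -
  have flip: "shift (x, False) (shift (y, c) g) = shift (y, c) (shift (x, False) g)"
    if "\<And>g. g \<in> carrier G \<Longrightarrow> shift (x, True) (shift (y, c) g) = shift (y, c) (shift (x, True) g)"
      "g \<in> carrier G" "x \<in> X" "y \<in> X" for x y c g
  proof -
    have "shift (y, c) g = shift (y, c) (shift (x, True) (shift (x, False) g))"
      using that shift_inverse[of g x False] by simp
    also have "\<dots> = shift (x, True) (shift (y, c) (shift (x, False) g))"
      using that by simp
    finally show ?thesis
      using that shift_inverse[of "shift (y, c) (shift (x, False) g)" x True] by simp
  qed
  have pos: "shift (x, True) (shift (y, c) g) = shift (y, c) (shift (x, True) g)"
    if "g \<in> carrier G" for g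
    using that assms flip[of y x True g] shift_commute_pos by (cases c) auto
  then show ?thesis
    using assms flip[of x y c g] by (cases b) auto
qed

abbreviation shifts :: "('a \<times> bool) list \<Rightarrow> ('a \<times> bool) list set" where
  "shifts s \<equiv> foldr shift s \<one>\<^bsub>G\<^esub>"

lemma shifts_closed [simp]: "s \<in> W \<Longrightarrow> shifts s \<in> carrier G"
  by (induction s) auto

lemma shifts_middle:
  assumes "s @ (x, b) # t \<in> W"
  shows "shifts (s @ (x, b) # t) = shift (x, b) (shifts (s @ t))"
  using assms
proof (induction s)
  case (Cons p s)
  then show ?case
    using shift_commute[of "shifts (s @ t)" "fst p" x "snd p" b] shifts_closed[of "s @ t"] by simp
qed simp

lemma shifts_surj:
  assumes "g \<in> carrier G"
  shows "\<exists>s\<in>W. g = shifts s"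
  using assms
proof (induction g rule: G_induct_shift)
  case one
  show ?case by (intro bexI[of _ "[]"]) auto
next
  case (shift g x b)
  then obtain s where "s \<in> W" "g = shifts s"
    by blast
  then show ?case
    using shift by (intro bexI[of _ "(x, b) # s"]) auto
qed

text \<open>Supplies the cancelling partner of a letter in \<open>gpi_zero\<close>.\<close>

lemma gpi_shifts_letter:
  assumes "s \<in> W"
  shows "gpi (shifts s) x > 0 \<Longrightarrow> (x, True) \<in> set s"
    and "gpi (shifts s) x < 0 \<Longrightarrow> (x, False) \<in> set s"
proof -
  have "(gpi (shifts s) x > 0 \<longrightarrow> (x, True) \<in> set s) \<and> (gpi (shifts s) x < 0 \<longrightarrow> (x, False) \<in> set s)"
    using assms
  proof (induction s)
    case (Cons p s)
    then show ?case
      using gpi_shift[of "shifts s" "fst p" "snd p" x] by (cases p) (auto split: if_splits)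
  qed simp
  then show "gpi (shifts s) x > 0 \<Longrightarrow> (x, True) \<in> set s" "gpi (shifts s) x < 0 \<Longrightarrow> (x, False) \<in> set s"
    by blast+
qed

text \<open>The first letter changes one coefficient by \<plusminus>1, so a total of 0 forces the
  opposite letter further on. Moved to the front of the remaining word it cancels, which leaves a
  shorter word for the same element.\<close>

lemma gpi_zero:
  assumes "s \<in> W" "\<And>z. gpi (shifts s) z = 0"
  shows "shifts s = \<one>\<^bsub>G\<^esub>"
  using assms
proof (induction s rule: length_induct)
  case (1 s)
  show ?case
  proof (cases s)
    case (Cons p s')
    obtain x b where p: "p = (x, b)"
      by (cases p)
    have x: "x \<in> X" "s' \<in> W"
      using 1 Cons p by auto
    have "gpi (shifts s') x = (if b then - 1 else 1)"
      using 1(3)[of x] gpi_shift[of "shifts s'" x b x] x Cons p by (auto split: if_splits)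
    then have "(x, \<not> b) \<in> set s'"
      using gpi_shifts_letter[of s' x] x by (cases b) auto
    then obtain u v where uv: "s' = u @ (x, \<not> b) # v"
      by (meson split_list)
    have "shifts s = shifts (u @ v)"
      using x shifts_middle[of u x "\<not> b" v] shift_inverse[of "shifts (u @ v)" x "\<not> b"]
        shifts_closed[of "u @ v"] Cons p uv
      by simp
    moreover have "shifts (u @ v) = \<one>\<^bsub>G\<^esub>"
      using 1(1)[rule_format, of "u @ v"] 1(3) \<open>shifts s = shifts (u @ v)\<close> x Cons uv by simp
    ultimately show ?thesis by simp
  qed simp
qed

lemma gpi_inj:
  assumes "g \<in> carrier G" "h \<in> carrier G" "\<And>z. gpi g z = gpi h z"
  shows "g = h"
proof -
  \<comment> \<open>Trivial kernel suffices: the cocycle at g^{-1} is minus the translate of its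
    value at g, so equal values at g and h give 0 at g^{-1} h.\<close>
  have "gpi (ginv g) z + gpi g (gact g z) = 0" for z
    using gpi_mult[of "ginv g" g z] assms(1) by simp
  then have "gpi (ginv g \<cdot> h) z = 0" for z
    using assms(1,2) by (simp add: gpi_mult assms(3)[symmetric])
  then have "ginv g \<cdot> h = \<one>\<^bsub>G\<^esub>"
    using gpi_zero shifts_surj assms by (metis G.inv_closed G.m_closed)
  then show ?thesis
    using assms by (metis G.inv_closed G.inv_equality G.inv_inv)
qed

lemma gen_inj: "x \<in> X \<Longrightarrow> y \<in> X \<Longrightarrow> gen x = gen y \<Longrightarrow> x = y"
  using gpi_gen[of x x] gpi_gen[of y x] by (metis zero_neq_one)

subsection \<open>The braiding of the structure group\<close>

text \<open>Adding e_x to the value at \<open>h\<close> is matched by adding e_(g.x) to its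
  translate.\<close>

lemma ex_gpi_translate:
  assumes "g \<in> carrier G" "h \<in> carrier G"
  shows "\<exists>k\<in>carrier G. \<forall>z. gpi k z = gpi h (gact (ginv g) z)"
  using assms(2)
proof (induction h rule: G_induct_shift)
  case one
  show ?case by (intro bexI[of _ "\<one>\<^bsub>G\<^esub>"]) auto
next
  case (shift h x b)
  then obtain k where k: "k \<in> carrier G" "\<And>z. gpi k z = gpi h (gact (ginv g) z)"
    by blast
  have "gact (ginv g) z = x \<longleftrightarrow> z = gact g x" for z
    using assms(1) gact_inverse by metis
  then show ?case
    using assms shift k by (intro bexI[of _ "shift (gact g x, b) k"]) (auto simp: gpi_shift)
qed

text \<open>The permutation action of \<open>g\<close> on Z^(X), pulled back along the injective
  cocycle.\<close>

definition lam where
  "lam g h = (THE k. k \<in> carrier G \<and> (\<forall>z. gpi k z = gpi h (gact (ginv g) z)))"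

lemma lam_closed [simp]: "g \<in> carrier G \<Longrightarrow> h \<in> carrier G \<Longrightarrow> lam g h \<in> carrier G"
  and gpi_lam: "g \<in> carrier G \<Longrightarrow> h \<in> carrier G \<Longrightarrow> gpi (lam g h) z = gpi h (gact (ginv g) z)"
proof -
  assume "g \<in> carrier G" "h \<in> carrier G"
  then have "\<exists>!k. k \<in> carrier G \<and> (\<forall>z. gpi k z = gpi h (gact (ginv g) z))"
    using ex_gpi_translate gpi_inj by metis
  from theI'[OF this] show "lam g h \<in> carrier G" "gpi (lam g h) z = gpi h (gact (ginv g) z)"
    unfolding lam_def by auto
qed

lemma lam_eqI:
  assumes "g \<in> carrier G" "h \<in> carrier G" "k \<in> carrier G" "\<And>z. gpi k z = gpi h (gact (ginv g) z)"
  shows "lam g h = k"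
  using assms by (intro gpi_inj) (simp_all add: gpi_lam)

text \<open>Forced by the compatibility uv = (^u v)(u^v).\<close>

definition rho where
  "rho g h = ginv (lam g h) \<cdot> g \<cdot> h"

lemma rho_closed [simp]: "g \<in> carrier G \<Longrightarrow> h \<in> carrier G \<Longrightarrow> rho g h \<in> carrier G"
  by (simp add: rho_def)

lemma cancel_left:
  assumes "a \<in> carrier G" "b \<in> carrier G"
  shows "a \<cdot> (ginv a \<cdot> b) = b" "ginv a \<cdot> (a \<cdot> b) = b"
  using assms by (simp_all flip: G.m_assoc)

lemma lam_mult_rho: "g \<in> carrier G \<Longrightarrow> h \<in> carrier G \<Longrightarrow> lam g h \<cdot> rho g h = g \<cdot> h"
  by (simp add: rho_def G.m_assoc cancel_left)

lemma lam_one [simp]: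
  "g \<in> carrier G \<Longrightarrow> lam g \<one>\<^bsub>G\<^esub> = \<one>\<^bsub>G\<^esub>" "g \<in> carrier G \<Longrightarrow> lam \<one>\<^bsub>G\<^esub> g = g"
  by (rule lam_eqI; simp)+

lemma lam_mult [simp]:
  assumes "a \<in> carrier G" "b \<in> carrier G" "u \<in> carrier G"
  shows "lam (a \<cdot> b) u = lam a (lam b u)"
  using assms by (intro lam_eqI) (simp_all add: gpi_lam G.inv_mult_group)

lemma lam_inverse [simp]:
  assumes "a \<in> carrier G" "u \<in> carrier G"
  shows "lam (ginv a) (lam a u) = u" "lam a (lam (ginv a) u) = u"
  using assms by (simp_all flip: lam_mult)

lemma lam_gen [simp]:
  assumes "g \<in> carrier G" "x \<in> X"
  shows "lam g (gen x) = gen (gact g x)"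
proof (rule lam_eqI)
  have "gact (ginv g) z = x \<longleftrightarrow> z = gact g x" for z
    using assms gact_inverse by metis
  then show "gpi (gen (gact g x)) z = gpi (gen x) (gact (ginv g) z)" for z
    using assms by simp
qed (use assms in auto)

lemma lam_inv_gen [simp]:
  assumes "g \<in> carrier G" "x \<in> X"
  shows "lam g (ginv (gen x)) = ginv (gen (gact g x))"
proof (rule lam_eqI)
  have "gact (ginv g) z = x \<longleftrightarrow> z = gact g x" for z
    using assms gact_inverse by metis
  then show "gpi (ginv (gen (gact g x))) z = gpi (ginv (gen x)) (gact (ginv g) z)" for z
    using assms by simp
qed (use assms in auto)

lemma lam_mult_arg:
  assumes "a \<in> carrier G" "u \<in> carrier G" "v \<in> carrier G"
  shows "lam a (u \<cdot> v) = lam a u \<cdot> lam (rho a u) v"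
proof (rule lam_eqI)
  fix z
  \<comment> \<open>\<open>lam a u \<cdot> rho a u\<close> is \<open>a \<cdot> u\<close>, so both
    move \<open>z\<close> alike; the rest is the cocycle identity on both sides.\<close>
  have "gact (ginv (rho a u)) (gact (ginv (lam a u)) z) = gact (ginv (lam a u \<cdot> rho a u)) z"
    using assms by (simp add: G.inv_mult_group)
  also have "\<dots> = gact (ginv u) (gact (ginv a) z)"
    using assms by (simp add: lam_mult_rho G.inv_mult_group)
  finally show "gpi (lam a u \<cdot> lam (rho a u) v) z = gpi (u \<cdot> v) (gact (ginv a) z)"
    using assms by (simp add: gpi_mult gpi_lam)
qed (use assms in auto)

text \<open>Involutivity reflects commutativity of Z^(X): both factorisations of uv have the value
  of \<open>lam u v\<close> as a summand, and it cancels.\<close>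

lemma lam_lam_rho:
  assumes "u \<in> carrier G" "v \<in> carrier G"
  shows "lam (lam u v) (rho u v) = u"
proof (rule lam_eqI)
  fix z
  have "gpi (lam u v \<cdot> rho u v) z = gpi (u \<cdot> v) z"
    using assms by (simp add: lam_mult_rho)
  then show "gpi u z = gpi (rho u v) (gact (ginv (lam u v)) z)"
    using assms by (simp add: gpi_mult gpi_lam)
qed (use assms in auto)

definition sigma where
  "sigma p = (if p \<in> carrier G \<times> carrier G then (lam (fst p) (snd p), rho (fst p) (snd p)) else p)"

lemma lact_sigma [simp]: "a \<in> carrier G \<Longrightarrow> b \<in> carrier G \<Longrightarrow> lact sigma a b = lam a b"
  and ract_sigma [simp]: "a \<in> carrier G \<Longrightarrow> b \<in> carrier G \<Longrightarrow> ract sigma a b = rho a b"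
  by (simp_all add: lact_def ract_def sigma_def)

lemma symmetric_group_sigma: "symmetric_group G sigma"
  unfolding symmetric_group_def
proof (intro conjI ballI)
  show "group G" by (rule group_G)
next
  fix u v assume uv: "u \<in> carrier G" "v \<in> carrier G"
  show "sigma (u, v) \<in> carrier G \<times> carrier G"
    using uv by (simp add: sigma_def)
  have "rho (lam u v) (rho u v) = v"
    using uv lam_mult_rho[of u v] by (simp add: rho_def[of "lam u v"] lam_lam_rho G.m_assoc cancel_left)
  then show "sigma (sigma (u, v)) = (u, v)"
    using uv by (simp add: sigma_def lam_lam_rho)
next
  fix a b u v assume "a \<in> carrier G" "b \<in> carrier G" "u \<in> carrier G" "v \<in> carrier G"
  note in_G = this
  show "lact sigma (a \<cdot> b) u = lact sigma a (lact sigma b u)"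
    using in_G by simp
  show "lact sigma a (u \<cdot> v) = lact sigma a u \<cdot> lact sigma (ract sigma a u) v"
    using in_G by (simp add: lam_mult_arg)
  show "u \<cdot> v = lact sigma u v \<cdot> ract sigma u v"
    using in_G by (simp add: lam_mult_rho)
  have "rho a (u \<cdot> v) = ginv (lam (rho a u) v) \<cdot> (ginv (lam a u) \<cdot> a \<cdot> u) \<cdot> v"
    using in_G unfolding rho_def[of a "u \<cdot> v"]
    by (simp add: lam_mult_arg G.inv_mult_group G.m_assoc)
  then show "ract sigma a (u \<cdot> v) = ract sigma (ract sigma a u) v"
    using in_G by (simp add: rho_def[of "rho a u"]) (simp add: rho_def)
  show "ract sigma (a \<cdot> b) u = ract sigma a (lact sigma b u) \<cdot> ract sigma b u"
    using in_G by (simp add: rho_def G.m_assoc cancel_left)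
qed (simp_all add: rho_def)

lemma sigma_gen:
  assumes "x \<in> X" "y \<in> X"
  shows "sigma (gen x, gen y) = (gen (x \<rhd> y), gen (x \<lhd> y))"
proof -
  have "ginv (gen (x \<rhd> y)) \<cdot> (gen x \<cdot> gen y) = gen (x \<lhd> y)"
    unfolding gen_braid[OF assms] using assms by (simp add: cancel_left)
  then show ?thesis
    using assms by (simp add: sigma_def rho_def G.m_assoc)
qed

text \<open>The cocycle intertwines every braiding that extends \<open>r\<close> with the action on functions; as the
  cocycle is injective, there is only one such braiding.\<close>

lemma braiding_unique:
  assumes sg: "symmetric_group G \<sigma>"
    and gen: "\<And>x y. x \<in> X \<Longrightarrow> y \<in> X \<Longrightarrow> \<sigma> (gen x, gen y) = (gen (x \<rhd> y), gen (x \<lhd> y))"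
    and a: "a \<in> carrier G" and b: "b \<in> carrier G"
  shows "\<sigma> (a, b) = (lam a b, rho a b)"
proof -
  let ?l = "lact \<sigma>" and ?r = "ract \<sigma>"
  note sg' = sg[unfolded symmetric_group_def, THEN conjunct2]
  have "\<sigma> (u, v) \<in> carrier G \<times> carrier G" if "u \<in> carrier G" "v \<in> carrier G" for u v
    using sg'[THEN conjunct1] that by blast
  then have cl [simp]: "?l u v \<in> carrier G" "?r u v \<in> carrier G"
    if "u \<in> carrier G" "v \<in> carrier G" for u v
    using that by (auto simp: lact_def ract_def mem_Times_iff)
  have units: "?l u \<one>\<^bsub>G\<^esub> = \<one>\<^bsub>G\<^esub>" "?l \<one>\<^bsub>G\<^esub> u = u" "?r u \<one>\<^bsub>G\<^esub> = u" if "u \<in> carrier G" for u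
    using sg'[THEN conjunct2, THEN conjunct1] that by blast+
  have mult: "?l (u \<cdot> v) w = ?l u (?l v w)" "?r u (v \<cdot> w) = ?r (?r u v) w"
      "?l u (v \<cdot> w) = ?l u v \<cdot> ?l (?r u v) w" "u \<cdot> v = ?l u v \<cdot> ?r u v"
    if "u \<in> carrier G" "v \<in> carrier G" "w \<in> carrier G" for u v w
    using sg'[THEN conjunct2, THEN conjunct2] that by blast+
  have gens: "?l (gen x) (gen y) = gen (x \<rhd> y)" if "x \<in> X" "y \<in> X" for x y
    using gen that by (simp add: lact_def)
  have l_inv_gen: "?l (ginv (gen x)) (gen y) = gen (y \<lhd> x)" if xy: "x \<in> X" "y \<in> X" for x y
  proof -
    have "?l (ginv (gen x)) (gen y) = ?l (ginv (gen x)) (?l (gen x) (gen (y \<lhd> x)))"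
      using xy by (simp add: gens)
    also have "\<dots> = gen (y \<lhd> x)"
      using xy by (simp add: units flip: mult(1))
    finally show ?thesis .
  qed
  have l_gen: "?l u (gen x) = gen (gact u x)" if "u \<in> carrier G" "x \<in> X" for u x
    using that by (induction u arbitrary: x rule: G_induct) (simp_all add: units mult(1) gens l_inv_gen)
  have r_rho: "?r u v = rho u v" if "u \<in> carrier G" "v \<in> carrier G" "?l u v = lam u v" for u v
    using mult(4)[OF that(1,2,2)] that by (simp add: rho_def G.m_assoc cancel_left)
  have l_arg_inv: "?l w (ginv (gen x)) = ginv (gen (gact w x))" if w: "w \<in> carrier G" "x \<in> X" for w x
  proof -
    \<comment> \<open>Chosen so that w = u^x. Expanding ^u(x x^{-1}) = 1 by the product rule shows
      that ^w(x^{-1}) is inverse to u.x, and u.x = w.x by square-freeness.\<close>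
    define u where "u = ?r w (ginv (gen x))"
    have u: "u \<in> carrier G"
      using w by (simp add: u_def)
    have "?r u (gen x) = ?r w (ginv (gen x) \<cdot> gen x)"
      unfolding u_def using w by (intro mult(2)[symmetric]) auto
    then have "w = ?r u (gen x)"
      using w by (simp add: units)
    then have w_eq: "w = rho u (gen x)"
      using r_rho u w by (simp add: l_gen)
    then have "gact w x = gact u x"
      using u w(2) by (simp add: rho_def)
    moreover have "gen (gact u x) \<cdot> ?l w (ginv (gen x)) = \<one>\<^bsub>G\<^esub>"
      using mult(3)[OF u, of "gen x" "ginv (gen x)"] u w(2) \<open>w = ?r u (gen x)\<close>
      by (simp add: l_gen units)
    ultimately show ?thesis
      using w G.inv_equality G.inv_comm by (metis cl(1) gact_closed gen_closed G.inv_closed)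
  qed
  \<comment> \<open>All \<open>u\<close> at once, since the product rule replaces \<open>u\<close>
    by \<open>?r u v\<close>.\<close>
  have "\<forall>u\<in>carrier G. ?l u v = lam u v" if "v \<in> carrier G" for v
    using that
  proof (induction v rule: G_induct)
    case one
    then show ?case by (simp add: units)
  next
    case (gen v x)
    then show ?case by (simp add: mult(3) lam_mult_arg r_rho l_gen)
  next
    case (inv v x)
    then show ?case by (simp add: mult(3) lam_mult_arg r_rho l_arg_inv)
  qed
  then have l: "?l a b = lam a b"
    using a b by blast
  then show ?thesis
    using r_rho[OF a b] by (simp add: lact_def ract_def prod_eq_iff)
qed

lemma assoc_braiding_eq: "assoc_braiding X r = sigma"
  unfolding assoc_braiding_def
proof (rule the_equality)
  show "symmetric_group G sigma \<and>
     (\<forall>x\<in>X. \<forall>y\<in>X. sigma (gen x, gen y) = (gen (x \<rhd> y), gen (x \<lhd> y))) \<and>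
     (\<forall>p. p \<notin> carrier G \<times> carrier G \<longrightarrow> sigma p = p)"
    using symmetric_group_sigma sigma_gen by (auto simp: sigma_def)
next
  fix \<sigma> assume *: "symmetric_group G \<sigma> \<and>
     (\<forall>x\<in>X. \<forall>y\<in>X. \<sigma> (gen x, gen y) = (gen (x \<rhd> y), gen (x \<lhd> y))) \<and>
     (\<forall>p. p \<notin> carrier G \<times> carrier G \<longrightarrow> \<sigma> p = p)"
  show "\<sigma> = sigma"
  proof
    fix p
    show "\<sigma> p = sigma p"
    proof (cases "p \<in> carrier G \<times> carrier G")
      case True
      then show ?thesis
        using braiding_unique[of \<sigma> "fst p" "snd p"] * by (auto simp: sigma_def)
    next
      case False
      then show ?thesis
        using * by (simp add: sigma_def del: split_paired_All)
    qed
  qed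
qed

subsection \<open>Multipermutation level two\<close>

lemma ret_one_1_iff: "ret_one X r 1 \<longleftrightarrow> X \<noteq> {} \<and> trivial_sol X r"
  unfolding ret_one_iff trivial_iff One_nat_def ret_rel.simps by (metis idem(1))

lemma has_mpl_Suc_iff: "has_mpl X r (Suc n) \<longleftrightarrow> ret_one X r (Suc n) \<and> \<not> ret_one X r n"
  unfolding has_mpl_def less_Suc_eq_le using ret_one_mono by (metis order_refl)

text \<open>Successors only: at level 0 the left side would say that Ret^j is a point, whereas the
  right side would also demand that j is minimal.\<close>

lemma has_mpl_ret: "has_mpl (ret_set X r j) (ret_sol X r j) (Suc n) \<longleftrightarrow> has_mpl X r (j + Suc n)"
  using sf_solution.has_mpl_Suc_iff[OF sf_solution_ret, of j n] has_mpl_Suc_iff[of "j + n"]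
  by (simp add: ret_one_ret)

lemma mpl2_iff:
  assumes "\<not> trivial_sol X r"
  shows "has_mpl X r 2 \<longleftrightarrow> (\<forall>x\<in>X. \<forall>y\<in>X. \<forall>z\<in>X. (x \<rhd> y) \<rhd> z = y \<rhd> z)"
proof -
  have "has_mpl X r 2 \<longleftrightarrow> ret_one X r 2"
    using assms has_mpl_Suc_iff[of 1] ret_one_1_iff by (simp add: numeral_2_eq_2)
  also have "\<dots> \<longleftrightarrow> (\<forall>x\<in>X. \<forall>y\<in>X. \<forall>z\<in>X. \<forall>w\<in>X. (x \<rhd> z) \<rhd> w = (y \<rhd> z) \<rhd> w)"
    using assms by (auto simp: ret_one_iff trivial_iff numeral_2_eq_2)
  \<comment> \<open>Independence of the acting point is tested against
    \<open>z \<rhd> z = z\<close>.\<close>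
  also have "\<dots> \<longleftrightarrow> (\<forall>x\<in>X. \<forall>y\<in>X. \<forall>z\<in>X. (x \<rhd> y) \<rhd> z = y \<rhd> z)"
    by (metis idem(1))
  finally show ?thesis .
qed

lemma nonabelian_iff: "nonabelian G \<longleftrightarrow> \<not> trivial_sol X r"
proof
  assume "nonabelian G"
  then obtain g h where gh: "g \<in> carrier G" "h \<in> carrier G" "g \<cdot> h \<noteq> h \<cdot> g"
    by (auto simp: nonabelian_def)
  show "\<not> trivial_sol X r"
  proof
    assume triv: "trivial_sol X r"
    then have ra: "x \<lhd> y = x" if "x \<in> X" "y \<in> X" for x y
      using that unfolding trivial_iff by (metis ra_la)
    have act: "gact k z = z" if "k \<in> carrier G" for k z
    proof (cases "z \<in> X")
      case True
      with that show ?thesis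
        using triv by (induction k rule: G_induct) (simp_all add: trivial_iff ra)
    qed (use that gact_outside in blast)
    \<comment> \<open>Under a trivial action the injective cocycle is a homomorphism into an abelian
      group.\<close>
    have "g \<cdot> h = h \<cdot> g"
      using gh by (intro gpi_inj) (simp_all add: gpi_mult act)
    with gh show False by simp
  qed
next
  assume "\<not> trivial_sol X r"
  then obtain x y where xy: "x \<in> X" "y \<in> X" "y \<rhd> x \<noteq> x"
    by (auto simp: trivial_iff)
  then have "x \<lhd> y \<noteq> x"
    by (metis la_ra)
  \<comment> \<open>The coefficients at \<open>x\<close> are 1 and 0.\<close>
  with xy have "gpi (gen x \<cdot> gen y) x \<noteq> gpi (gen y \<cdot> gen x) x"
    by (auto simp: gpi_mult)
  then show "nonabelian G"
    using xy gen_closed unfolding nonabelian_def by metis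
qed

section \<open>Conditions on the braided group compared with left invariance\<close>

lemma lam_cong:
  assumes "a \<in> carrier G" "b \<in> carrier G" "u \<in> carrier G" "\<And>x. x \<in> X \<Longrightarrow> gact a x = gact b x"
  shows "lam a u = lam b u"
proof (rule lam_eqI)
  fix z
  have "gact a x = gact b x" for x
    using assms gact_outside by (cases "x \<in> X") auto
  then have "gact (ginv b) z = gact (ginv a) z"
    using assms gact_inverse by metis
  then show "gpi (lam b u) z = gpi u (gact (ginv a) z)"
    using assms by (simp add: gpi_lam)
qed (use assms in auto)

lemma rho_eq_lam:
  assumes "a \<in> carrier G" "b \<in> carrier G"
  shows "rho a b = lam (ginv (lam a b)) a"
  using assms lam_lam_rho[of a b] lam_inverse(1)[of "lam a b" "rho a b"] by simp

lemma L_invariantD: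
  "L_invariant G sigma \<Longrightarrow> a \<in> carrier G \<Longrightarrow> b \<in> carrier G \<Longrightarrow> u \<in> carrier G
    \<Longrightarrow> lam (lam b a) u = lam a u"
  unfolding L_invariant_def by (metis lact_sigma lam_closed)

lemma L_invariant_iff:
  "L_invariant G sigma \<longleftrightarrow> (\<forall>x\<in>X. \<forall>y\<in>X. \<forall>z\<in>X. (x \<rhd> y) \<rhd> z = y \<rhd> z)"
proof
  assume L: "L_invariant G sigma"
  show "\<forall>x\<in>X. \<forall>y\<in>X. \<forall>z\<in>X. (x \<rhd> y) \<rhd> z = y \<rhd> z"
  proof (intro ballI)
    fix x y z assume "x \<in> X" "y \<in> X" "z \<in> X"
    then show "(x \<rhd> y) \<rhd> z = y \<rhd> z"
      using L_invariantD[OF L, of "gen y" "gen x" "gen z"] by (auto dest: gen_inj[rotated 2])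
  qed
next
  assume X: "\<forall>x\<in>X. \<forall>y\<in>X. \<forall>z\<in>X. (x \<rhd> y) \<rhd> z = y \<rhd> z"
  have X': "(y \<lhd> x) \<rhd> z = y \<rhd> z" if "x \<in> X" "y \<in> X" "z \<in> X" for x y z
    using X that by (metis closed(2) la_ra)
  have la: "gact h x \<rhd> z = x \<rhd> z" if "h \<in> carrier G" "x \<in> X" "z \<in> X" for h x z
    using that by (induction h arbitrary: x rule: G_induct) (simp_all add: X X')
  have ra: "z \<lhd> gact h x = z \<lhd> x" if "h \<in> carrier G" "x \<in> X" "z \<in> X" for h x z
    using that la[of h x "z \<lhd> x"] ra_la[of "z \<lhd> x" "gact h x"] by simp
  \<comment> \<open>The letters of \<open>lam b g\<close> are those of \<open>g\<close> moved within
    their orbits, so by \<open>la\<close> and \<open>ra\<close> they act as before.\<close>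
  have act: "\<forall>b\<in>carrier G. \<forall>z\<in>X. gact (lam b g) z = gact g z" if "g \<in> carrier G" for g
    using that by (induction g rule: G_induct) (simp_all add: lam_mult_arg la ra)
  show "L_invariant G sigma"
    unfolding L_invariant_def using act by (simp add: lam_cong[of "lam b a" a for a b])
qed

text \<open>Compared with the product rule for ^a(bc), acting by automorphisms means that
  \<open>rho a b\<close> acts as \<open>a\<close> does.\<close>

lemma acts_as_automorphisms_iff: "acts_as_automorphisms G sigma \<longleftrightarrow> L_invariant G sigma"
proof
  assume aut: "acts_as_automorphisms G sigma"
  have rho: "lam (rho a b) c = lam a c" if "a \<in> carrier G" "b \<in> carrier G" "c \<in> carrier G" for a b c
  proof -
    have "lact sigma a (b \<cdot> c) = lact sigma a b \<cdot> lact sigma a c"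
      using aut that unfolding acts_as_automorphisms_def by blast
    then show ?thesis
      using that by (simp add: lam_mult_arg)
  qed
  have "lam (lam b a) u = lam a u" if "a \<in> carrier G" "b \<in> carrier G" "u \<in> carrier G" for a b u
    \<comment> \<open>Each \<open>lam b a\<close> is some \<open>rho a c\<close>: take c with ^a c =
      b^{-1} and use \<open>rho_eq_lam\<close>.\<close>
    using that rho[of a "lam (ginv a) (ginv b)" u] by (simp add: rho_eq_lam del: lam_mult)
  then show "L_invariant G sigma"
    unfolding L_invariant_def by simp
next
  assume L: "L_invariant G sigma"
  have "lam (rho a b) c = lam a c" if "a \<in> carrier G" "b \<in> carrier G" "c \<in> carrier G" for a b c
    using that L_invariantD[OF L, of "rho a b" "lam a b" c] by (simp add: lam_lam_rho)
  then show "acts_as_automorphisms G sigma"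
    unfolding acts_as_automorphisms_def by (simp add: lam_mult_arg)
qed

text \<open>By \<open>rho_eq_lam\<close>, b^a arises from \<open>b\<close> through the inverse of
  \<open>lam b a\<close>, which acts like \<open>a\<close>.\<close>

lemma rho_eq_lam_inv:
  assumes "L_invariant G sigma" "a \<in> carrier G" "b \<in> carrier G"
  shows "rho b a = lam (ginv a) b"
  using assms L_invariantD[OF assms(1,2,3), of "lam (ginv a) b"]
    lam_inverse(1)[of "lam b a" "lam (ginv a) b"]
  by (simp add: rho_eq_lam)

lemma gpi_brace_add:
  assumes "a \<in> carrier G" "b \<in> carrier G"
  shows "gpi (brace_add G sigma a b) z = gpi a z + gpi b z"
  using assms by (simp add: brace_add_def gpi_mult gpi_lam)

lemma brace_add_closed [simp]:
  "a \<in> carrier G \<Longrightarrow> b \<in> carrier G \<Longrightarrow> brace_add G sigma a b \<in> carrier G"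
  by (simp add: brace_add_def)

text \<open>The element \<open>zzx\<close> is \<open>2z + (z \<rhd> z \<rhd> x)\<close> in the brace; the coefficient 2
  distinguishes the first summand from the second one.\<close>

lemma left_invariant_if_rho_zzx:
  assumes rho: "\<And>x y z. x \<in> X \<Longrightarrow> y \<in> X \<Longrightarrow> z \<in> X \<Longrightarrow>
      rho (gen z \<cdot> gen z \<cdot> gen x) (gen y) = lam (ginv (gen y)) (gen z \<cdot> gen z \<cdot> gen x)"
    and "x \<in> X" "y \<in> X" "w \<in> X"
  shows "(x \<rhd> y) \<rhd> w = y \<rhd> w"
proof -
  \<comment> \<open>Then the value at \<open>w\<close> of the right side of the hypothesis is the
    coefficient of \<open>z\<close> in zzx.\<close>
  define z where "z = y \<rhd> w"
  have X: "x \<in> X" "y \<in> X" "w \<in> X" "z \<in> X"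
    using assms by (simp_all add: z_def)
  \<comment> \<open>The image of \<open>y\<close> under zzx, whose inverse determines
    \<open>rho\<close> by \<open>rho_eq_lam\<close>.\<close>
  define t where "t = z \<rhd> z \<rhd> x \<rhd> y"
  have t: "t \<in> X"
    using X by (simp add: t_def)
  let ?b = "gen z \<cdot> gen z \<cdot> gen x"
  have b: "gpi ?b v = (if v = z then 2 else 0) + (if v = z \<rhd> z \<rhd> x then 1 else 0)"
    if "v \<in> X" for v
  proof -
    have "v \<lhd> z = z \<longleftrightarrow> v = z" "v \<lhd> z \<lhd> z = x \<longleftrightarrow> v = z \<rhd> z \<rhd> x"
      using that X by (metis idem(2) la_ra, metis closed la_ra ra_la)
    then show ?thesis
      using that X by (simp add: gpi_mult G.inv_mult_group)
  qed
  have "rho ?b (gen y) = lam (ginv (gen t)) ?b"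
    using X by (simp add: rho_eq_lam t_def del: lam_mult)
  then have "gpi (lam (ginv (gen t)) ?b) w = gpi (lam (ginv (gen y)) ?b) w"
    using rho X by simp
  then have "gpi ?b (t \<rhd> w) = gpi ?b z"
    using X t by (simp add: gpi_lam del: lam_mult) (simp add: z_def)
  \<comment> \<open>The coefficient at \<open>z\<close> is 2, or 3 if
    \<open>z \<rhd> z \<rhd> x = z\<close>; at any other point it is at most 1.\<close>
  then have "t \<rhd> w = z"
    using X t by (auto simp: b split: if_splits)
  then have "w = z \<lhd> t"
    using X t ra_la by metis
  \<comment> \<open>Two applications of \<open>ra_ra\<close> strip both copies of \<open>z\<close>
    from \<open>t\<close>.\<close>
  also have "\<dots> = z \<lhd> (x \<rhd> y)"
    using X by (simp add: t_def ra_ra)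
  finally have "(x \<rhd> y) \<rhd> w = z"
    using X by simp
  then show ?thesis
    by (simp add: z_def)
qed

text \<open>lri says that b^a = ^(a^{-1}) b; its instances with b = zzx and \<open>a\<close> a
  generator feed \<open>left_invariant_if_rho_zzx\<close>.\<close>

lemma lri_iff: "lri G sigma \<longleftrightarrow> L_invariant G sigma"
proof
  assume lri: "lri G sigma"
  have "lam a (rho b a) = b" if "a \<in> carrier G" "b \<in> carrier G" for a b
    using lri that unfolding lri_def by simp
  then have "rho b a = lam (ginv a) b" if "a \<in> carrier G" "b \<in> carrier G" for a b
    using that by (metis lam_inverse(1) rho_closed)
  then show "L_invariant G sigma"
    unfolding L_invariant_iff by (intro ballI left_invariant_if_rho_zzx) auto
next
  assume L: "L_invariant G sigma"
  then show "lri G sigma"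
    unfolding lri_def by (simp add: rho_eq_lam_inv)
qed

text \<open>On generators right and inverse left actions agree by lri on \<open>X\<close>. Left
  actions are additive, and Raut makes right ones additive, so the agreement extends to zzx, a sum
  of generators.\<close>

lemma raut_iff: "raut G sigma \<longleftrightarrow> L_invariant G sigma"
proof
  assume raut: "raut G sigma"
  let ?add = "brace_add G sigma"
  have rho: "rho (?add a b) c = ?add (rho a c) (rho b c)"
    if "a \<in> carrier G" "b \<in> carrier G" "c \<in> carrier G" for a b c
    using raut that unfolding raut_def by simp
  have rho_gen: "rho (gen x) (gen y) = gen (x \<lhd> y)" if "x \<in> X" "y \<in> X" for x y
    using sigma_gen[OF that] that by (simp add: sigma_def)
  have add_gen: "lam g (?add a b) = ?add (lam g a) (lam g b)"
    if "g \<in> carrier G" "a \<in> carrier G" "b \<in> carrier G" for g a b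
    using that by (intro gpi_inj) (simp_all add: gpi_lam gpi_brace_add)
  have "rho (gen z \<cdot> gen z \<cdot> gen x) (gen y) = lam (ginv (gen y)) (gen z \<cdot> gen z \<cdot> gen x)"
    if "x \<in> X" "y \<in> X" "z \<in> X" for x y z
  proof -
    have "gen z \<cdot> gen z = ?add (gen z) (gen z)"
      using that by (simp add: brace_add_def)
    moreover have "gen z \<cdot> gen z \<cdot> gen x = ?add (gen z \<cdot> gen z) (gen (z \<rhd> z \<rhd> x))"
      using that by (simp add: brace_add_def G.inv_mult_group)
    ultimately have eq: "gen z \<cdot> gen z \<cdot> gen x = ?add (?add (gen z) (gen z)) (gen (z \<rhd> z \<rhd> x))"
      by simp
    show ?thesis
      unfolding eq using that by (simp add: rho add_gen rho_gen)
  qed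
  then show "L_invariant G sigma"
    unfolding L_invariant_iff by (intro ballI left_invariant_if_rho_zzx)
next
  assume L: "L_invariant G sigma"
  have "rho (brace_add G sigma a b) c = brace_add G sigma (rho a c) (rho b c)"
    if "a \<in> carrier G" "b \<in> carrier G" "c \<in> carrier G" for a b c
    using that by (intro gpi_inj) (simp_all add: rho_eq_lam_inv[OF L] gpi_lam gpi_brace_add)
  then show "raut G sigma"
    unfolding raut_def by simp
qed

lemma has_mpl_struct_group_iff:
  assumes "\<not> trivial_sol X r"
  shows "has_mpl (carrier G) sigma 2 \<longleftrightarrow> L_invariant G sigma"
proof -
  \<comment> \<open>The minimality lemmas above concern the square-free set \<open>X\<close>; for
    \<open>G\<close> levels 0 and 1 are excluded directly.\<close>
  have not_one: "\<not> ret_one (carrier G) sigma 1"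
  proof
    assume "ret_one (carrier G) sigma 1"
    then have "\<forall>a\<in>carrier G. \<forall>b\<in>carrier G. \<forall>u\<in>carrier G. lact sigma a u = lact sigma b u"
      unfolding ret_one_iff One_nat_def ret_rel.simps by blast
    then have "lact sigma (gen x) (gen y) = lact sigma \<one>\<^bsub>G\<^esub> (gen y)" if "x \<in> X" "y \<in> X" for x y
      using that gen_closed G.one_closed by blast
    then have "x \<rhd> y = y" if "x \<in> X" "y \<in> X" for x y
      using that gen_inj[of "x \<rhd> y" y] by simp
    then show False
      using assms by (simp add: trivial_iff)
  qed
  then have not_zero: "\<not> ret_one (carrier G) sigma 0"
    unfolding ret_one_iff One_nat_def ret_rel.simps by metis
  have "k < 2 \<longleftrightarrow> k = 0 \<or> k = 1" for k :: nat
    by auto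
  then have "has_mpl (carrier G) sigma 2 \<longleftrightarrow> ret_one (carrier G) sigma 2"
    using not_one not_zero unfolding has_mpl_def by metis
  also have "\<dots> \<longleftrightarrow> L_invariant G sigma"
  proof
    assume "ret_one (carrier G) sigma 2"
    \<comment> \<open>Level 2 compares the translates of \<open>a\<close> by any two elements; one
      of them is taken to be the unit.\<close>
    then have "lact sigma (lact sigma b a) u = lact sigma (lact sigma \<one>\<^bsub>G\<^esub> a) u"
      if "a \<in> carrier G" "b \<in> carrier G" "u \<in> carrier G" for a b u
      using that G.one_closed unfolding ret_one_iff numeral_2_eq_2 ret_rel.simps by blast
    then show "L_invariant G sigma"
      unfolding L_invariant_def by simp
  next
    assume L: "L_invariant G sigma"
    then have "ret_rel (carrier G) sigma 2 a b" if "a \<in> carrier G" "b \<in> carrier G" for a b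
      using that by (simp add: numeral_2_eq_2 L_invariantD)
    then show "ret_one (carrier G) sigma 2"
      unfolding ret_one_iff using G.one_closed by blast
  qed
  finally show ?thesis .
qed

lemma mpl2_iff_L_invariant:
  "\<not> trivial_sol X r \<Longrightarrow> has_mpl X r 2 \<longleftrightarrow> L_invariant G sigma"
  by (simp add: mpl2_iff L_invariant_iff)

text \<open>This form also covers trivial solutions, where both sides are false, because a
  retraction of a nontrivial solution may be trivial.\<close>

lemma mpl2_iff_nonabelian_lri:
  "has_mpl X r 2 \<longleftrightarrow> nonabelian G \<and> lri G (assoc_braiding X r)"
proof (cases "trivial_sol X r")
  case True
  then have "\<not> has_mpl X r 2"
    using has_mpl_Suc_iff[of 1] ret_one_1_iff by (auto simp: numeral_2_eq_2 ret_one_iff)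
  then show ?thesis
    using True by (simp add: nonabelian_iff)
next
  case False
  then show ?thesis
    by (simp add: nonabelian_iff lri_iff mpl2_iff_L_invariant assoc_braiding_eq)
qed

end

theorem mainTheorem16:
  fixes X :: "'a set" and r :: "'a \<times> 'a \<Rightarrow> 'a \<times> 'a"
  assumes "symmetric_set X r" and "square_free X r" and "\<not> trivial_sol X r"
    and "S_embeds X r"
  shows
   "(has_mpl X r 2 \<longleftrightarrow> has_mpl (carrier (struct_group X r)) (assoc_braiding X r) 2) \<and>
    (has_mpl X r 2 \<longleftrightarrow> acts_as_automorphisms (struct_group X r) (assoc_braiding X r)) \<and>
    (has_mpl X r 2 \<longleftrightarrow> L_invariant (struct_group X r) (assoc_braiding X r)) \<and>
    (has_mpl X r 2 \<longleftrightarrow> lri (struct_group X r) (assoc_braiding X r)) \<and>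
    (has_mpl X r 2 \<longleftrightarrow> raut (struct_group X r) (assoc_braiding X r)) \<and>
    (\<forall>m::nat. m \<ge> 2 \<longrightarrow>
       (has_mpl X r m \<longleftrightarrow>
          nonabelian (struct_group (ret_set X r (m - 2)) (ret_sol X r (m - 2))) \<and>
          lri (struct_group (ret_set X r (m - 2)) (ret_sol X r (m - 2)))
              (assoc_braiding (ret_set X r (m - 2)) (ret_sol X r (m - 2)))))"
proof -
  interpret sf_solution X r
    using assms by unfold_locales
  have "has_mpl X r m \<longleftrightarrow> nonabelian (struct_group (ret_set X r (m - 2)) (ret_sol X r (m - 2))) \<and>
      lri (struct_group (ret_set X r (m - 2)) (ret_sol X r (m - 2)))
          (assoc_braiding (ret_set X r (m - 2)) (ret_sol X r (m - 2)))" if m: "m \<ge> 2" for m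
  proof -
    \<comment> \<open>Ret^j has level 2 exactly if \<open>X\<close> has level j + 2, by
      \<open>has_mpl_ret\<close> with \<open>n = 1\<close>.\<close>
    obtain j where "m = j + 2"
      using le_add_diff_inverse2[OF m] by metis
    then show ?thesis
      using sf_solution.mpl2_iff_nonabelian_lri[OF sf_solution_ret, of j] has_mpl_ret[of j 1]
      by (simp add: numeral_2_eq_2)
  qed
  then show ?thesis
    unfolding assoc_braiding_eq acts_as_automorphisms_iff lri_iff raut_iff
      has_mpl_struct_group_iff[OF assms(3)] mpl2_iff_L_invariant[OF assms(3)]
    by blast
qed

end
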